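(* Let $\mathcal{X}\subset\mathbb{R}^d$, $A\subset\mathbb{R}^m$ be finite (nonempty), $r:\mathcal{X}\times A\times\mathcal{X}\to\mathbb{R}$, $\alpha\in(0,1)$, $\varepsilon>0$, and $q\ge1$ an integer. Let $\mathcal{X}\times A\ni(x,a)\mapsto\widehat{\mathbb{P}}(x,a)\in\mathcal{M}_1(\mathcal{X})$ be continuous in the Wasserstein-$q$ topology, and set $$\mathcal{P}^{(q,\varepsilon)}(x,a)=\{\mathbb{P}\in\mathcal{M}_1(\mathcal{X}) : W_q(\mathbb{P},\widehat{\mathbb{P}}(x,a))\le\varepsilon\}.$$ For integers $n\ge1$ let $$G^{(n)}=\Big\{\mathbb{P}\in\mathcal{M}_1(\mathcal{X}) : \text{for all } y\in\mathcal{X},\ \mathbb{P}(y)=\tfrac{k_y}{n}\text{ for some }k_y\in\{0,1,\dots,n\}\Big\},\qquad \mathcal{P}^{(n)}(x,a)=\mathcal{P}^{(q,\varepsilon)}(x,a)\cap G^{(n)}.$$ (i) Let $(x,a)\in\mathcal{X}\times A$ and $\mathbb{P}\in\mathcal{P}^{(q,\varepsilon)}(x,a)$. Then for all integers $p\ge1$ and $n\ge1$ there exists $\mathbb{P}^{(n)}\in G^{(n)}$ with $$W_p(\mathbb{P}^{(n)},\mathbb{P})\le\frac{\max_{y,y'\in\mathcal{X}}\|y-y'\|\cdot|\mathcal{X}|^{1/p}}{n^{1/p}}.$$ (ii) Let $V$ and $V^{(n)}$ be the robust value functions associated with the ambiguity sets $\mathcal{P}^{(q,\varepsilon)}$ and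 $\mathcal{P}^{(n)}$, respectively, and for $(x,a)\in\mathcal{X}\times A$ define $$Q^{(n)*}(x,a)=\inf_{\mathbb{P}\in\mathcal{P}^{(n)}(x,a)}\mathbb{E}_{\mathbb{P}}[r(x,a,X_1)+\alpha V^{(n)}(X_1)],\qquad Q^*(x,a)=\inf_{\mathbb{P}\in\mathcal{P}^{(q,\varepsilon)}(x,a)}\mathbb{E}_{\mathbb{P}}[r(x,a,X_1)+\alpha V(X_1)].$$ Then there exists $n_0$ such that for all $n\ge n_0$, $$\sup_{(x,a)\in\mathcal{X}\times A}|Q^*(x,a)-Q^{(n)*}(x,a)|\le\frac{C}{n^{1/q}},\qquad C=\frac{(L_r+\alpha L_V)\big(\varepsilon+\max_{y,y'\in\mathcal{X}}\|y-y'\|\cdot|\mathcal{X}|^{1/q}\big)}{1-\alpha}<\infty,$$ where $$L_r=\max_{(x,a)\in\mathcal{X}\times A}\ \max_{y\ne y'\in\mathcal{X}}\frac{|r(x,a,y)-r(x,a,y')|}{\|y-y'\|}<\infty,\qquad L_V=\max_{y\neq y'\in\mathcal{X}}\frac{|V(y)-V(y')|}{\|y-y'\|}<\infty.$$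
   Context: $\mathcal{M}_1(\mathcal{X})$ is the set of probability measures on $\mathcal{X}$, $\|\cdot\|$ the Euclidean norm on $\mathbb{R}^d$, $|\mathcal{X}|$ the number of states. $W_q(\mathbb{P}_1,\mathbb{P}_2)=\big(\inf_{\pi\in\Pi(\mathbb{P}_1,\mathbb{P}_2)}\int\|x-y\|^q\,d\pi(x,y)\big)^{1/q}$, with $\Pi(\mathbb{P}_1,\mathbb{P}_2)$ the set of couplings of $\mathbb{P}_1$ and $\mathbb{P}_2$. For an ambiguity set $\mathcal{R}$, i.e. an assignment $(x,a)\mapsto\mathcal{R}(x,a)\subseteq\mathcal{M}_1(\mathcal{X})$, the associated robust value function is $$V^{\mathcal{R}}(x)=\sup_{\mathbf{a}\in\mathcal{A}}\inf_{\mathbb{P}\in\mathfrak{P}_{x,\mathbf{a}}}\mathbb{E}_{\mathbb{P}}\Big[\sum_{t=0}^\infty\alpha^tr(X_t,a_t(X_t),X_{t+1})\Big],\qquad x\in\mathcal{X},$$ where $\mathcal{A}$ is the set of policies $\mathbf{a}=(a_t)_{t\ge0}$ with $a_t:\mathcal{X}\to A$, and $\mathfrak{P}_{x,\mathbf{a}}$ is the set of laws $\delta_x\otimes\mathbb{P}_0\otimes\mathbb{P}_1\otimes\cdots$ of processes $(X_t)_{t\ge0}$ on $\mathcal{X}$ ($X_0=x$, and $X_{t+1}$ has conditional law $\mathbb{P}_t(X_t)$ given $X_0,\dots,X_t$) with kernels $\mathbb{P}_t:\mathcal{X}\to\mathcal{M}_1(\mathcal{X})$ satisfying $\mathbb{P}_t(x_t)\in\mathcal{R}(x_t,a_t(x_t))$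 for all $x_t\in\mathcal{X}$, $t\ge0$. In $\mathbb{E}_{\mathbb{P}}[\,\cdot\,]$ with $\mathbb{P}\in\mathcal{M}_1(\mathcal{X})$, $X_1$ has law $\mathbb{P}$. *)

theory Defs
  imports "HOL-Probability.Probability"
begin

text \<open>For finite \<open>X\<close> every measure below lives on the \<open>\<sigma>\<close>-algebra of all subsets of \<open>X\<close>.\<close>

abbreviation M1 :: "'a set \<Rightarrow> 'a measure set"
  where "M1 X \<equiv> space (prob_algebra (count_space X))"

definition couplings :: "'a set \<Rightarrow> 'a measure \<Rightarrow> 'a measure \<Rightarrow> ('a \<times> 'a) measure set"
  where "couplings X P1 P2 =
    {\<pi> \<in> space (prob_algebra (count_space X \<Otimes>\<^sub>M count_space X)).
       distr \<pi> (count_space X) fst = P1 \<and> distr \<pi> (count_space X) snd = P2}"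

definition wasserstein ::
  "'a::real_normed_vector set \<Rightarrow> nat \<Rightarrow> 'a measure \<Rightarrow> 'a measure \<Rightarrow> real"
  where "wasserstein X q P1 P2 =
    (INF \<pi>\<in>couplings X P1 P2. \<integral>(x, y). norm (x - y) ^ q \<partial>\<pi>) powr (1 / real q)"

definition wasserstein_ball ::
  "'a::real_normed_vector set \<Rightarrow> nat \<Rightarrow> real \<Rightarrow> 'a measure \<Rightarrow> 'a measure set"
  where "wasserstein_ball X q \<epsilon> P0 = {P \<in> M1 X. wasserstein X q P P0 \<le> \<epsilon>}"

definition grid_measures :: "'a set \<Rightarrow> nat \<Rightarrow> 'a measure set"
  where "grid_measures X n =
    {P \<in> M1 X. \<forall>y\<in>X. \<exists>k\<in>{0..n}. measure P {y} = real k / real n}"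

definition policies :: "'a set \<Rightarrow> 'b set \<Rightarrow> (nat \<Rightarrow> 'a \<Rightarrow> 'b) set"
  where "policies X A = {a. \<forall>t. a t \<in> X \<rightarrow> A}"

definition admissible_kernels ::
  "'a set \<Rightarrow> ('a \<Rightarrow> 'b \<Rightarrow> 'a measure set) \<Rightarrow> (nat \<Rightarrow> 'a \<Rightarrow> 'b) \<Rightarrow> (nat \<Rightarrow> 'a \<Rightarrow> 'a measure) set"
  where "admissible_kernels X R a = {K. \<forall>t. \<forall>y\<in>X. K t y \<in> R y (a t y)}"

fun step_kernel ::
  "'a set \<Rightarrow> 'a \<Rightarrow> (nat \<Rightarrow> 'a \<Rightarrow> 'a measure) \<Rightarrow> nat \<Rightarrow> (nat \<Rightarrow> 'a) \<Rightarrow> 'a measure"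
  where
    "step_kernel X x K 0 \<omega> = return (count_space X) x"
  | "step_kernel X x K (Suc t) \<omega> = K t (\<omega> t)"

text \<open>The measure \<open>\<delta>\<^sub>x \<otimes> K\<^sub>0 \<otimes> K\<^sub>1 \<otimes> \<dots>\<close> on sequences in \<open>X\<close>, i.e. the projective limit provided by the
  Ionescu-Tulcea theorem; see \<open>Ionescu_Tulcea_step_kernel\<close> and \<open>emeasure_path_law_cylinder\<close> below.\<close>

definition path_law ::
  "'a set \<Rightarrow> 'a \<Rightarrow> (nat \<Rightarrow> 'a \<Rightarrow> 'a measure) \<Rightarrow> (nat \<Rightarrow> 'a) measure"
  where "path_law X x K =
    projective_family.lim UNIV
      (Ionescu_Tulcea.CI (step_kernel X x K) (\<lambda>_. count_space X)) (\<lambda>_. count_space X)"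

lemma Ionescu_Tulcea_step_kernel:
  assumes "x \<in> X" "\<And>t y. y \<in> X \<Longrightarrow> K t y \<in> M1 X"
  shows "Ionescu_Tulcea (step_kernel X x K) (\<lambda>_. count_space X)"
proof (rule Ionescu_Tulcea.intro)
  fix i :: nat
  show "step_kernel X x K i \<in> measurable (PiM {0..<i} (\<lambda>_. count_space X)) (subprob_algebra (count_space X))"
  proof (cases i)
    case 0
    have "return (count_space X) x \<in> space (subprob_algebra (count_space X))"
      using assms by (auto simp: space_subprob_algebra intro!: prob_space_imp_subprob_space prob_space_return)
    then show ?thesis using 0 by (simp add: step_kernel.simps(1)[abs_def])
  next
    case (Suc t)
    have "K t \<in> measurable (count_space X) (subprob_algebra (count_space X))"
      using assms by (auto simp: space_subprob_algebra space_prob_algebra intro!: prob_space_imp_subprob_space)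
    moreover have "(\<lambda>\<omega>. \<omega> t) \<in> measurable (PiM {0..<i} (\<lambda>_. count_space X)) (count_space X)"
      using Suc by (intro measurable_component_singleton) auto
    ultimately show ?thesis
      using Suc by (auto simp: step_kernel.simps(2)[abs_def] simp del: measurable_count_space_eq1
        intro: measurable_compose[of "\<lambda>\<omega>. \<omega> t"])
  qed
next
  fix i :: nat and \<omega> assume "\<omega> \<in> space (PiM {0..<i} (\<lambda>_. count_space X))"
  then show "prob_space (step_kernel X x K i \<omega>)"
    using assms by (cases i) (auto simp: space_prob_algebra space_PiM PiE_iff intro!: prob_space_return)
qed

lemma emeasure_path_law_cylinder:
  assumes x: "x \<in> X" and K: "\<And>t y. y \<in> X \<Longrightarrow> K t y \<in> M1 X" and w: "\<And>s. s \<le> t \<Longrightarrow> w s \<in> X"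
  shows "emeasure (path_law X x K) {\<omega> \<in> space (path_law X x K). \<forall>s\<le>t. \<omega> s = w s} =
    indicator {x} (w 0) * (\<Prod>s<t. emeasure (K s (w s)) {w (Suc s)})"
proof -
  let ?P = "step_kernel X x K" and ?M = "\<lambda>_::nat. count_space X"
  interpret IT: Ionescu_Tulcea ?P ?M
    by (rule Ionescu_Tulcea_step_kernel[OF x K])
  define A where "A n = PiE {0..<n} (\<lambda>i. {w i})" for n
  define u where "u = (\<lambda>_::nat. undefined :: 'a)"
  have u: "u \<in> space (PiM {0..<0} ?M)"
    by (simp add: u_def space_PiM PiE_def extensional_def)
  have A_sets: "A n \<in> sets (PiM {0..<n} ?M)" if "n \<le> Suc t" for n
    unfolding A_def using w that by (intro sets_PiM_I_finite) auto
  have step: "emeasure (IT.C 0 (Suc n) u) (A (Suc n)) =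
      emeasure (IT.C 0 n u) (A n) * emeasure (?P n w) {w n}" if n: "n \<le> t" for n
  proof -
    have sp: "space (IT.C 0 n u) = space (PiM {0..<n} ?M)"
      using IT.space_C[OF u] by simp
    have "emeasure (IT.C 0 (Suc n) u) (A (Suc n)) = (\<integral>\<^sup>+\<omega>. emeasure (IT.eP n \<omega>) (A (Suc n)) \<partial>IT.C 0 n u)"
      using A_sets[of "Suc n"] n IT.measurable_eP[of n]
      by (simp, subst emeasure_bind[where N="PiM {0..<Suc n} ?M"])
         (use x in \<open>auto simp: sp measurable_cong_sets[OF IT.sets_C[OF u, of n] refl] space_PiM_empty_iff\<close>)
    also have "\<dots> = (\<integral>\<^sup>+\<omega>. emeasure (?P n w) {w n} * indicator (A n) \<omega> \<partial>IT.C 0 n u)"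
    proof (rule nn_integral_cong)
      fix \<omega> assume "\<omega> \<in> space (IT.C 0 n u)"
      then have \<omega>: "\<omega> \<in> space (PiM {0..<n} ?M)" by (simp add: sp)
      have "emeasure (IT.eP n \<omega>) (A (Suc n)) = emeasure (?P n \<omega>) (fun_upd \<omega> n -` A (Suc n) \<inter> X)"
        using IT.emeasure_eP[OF \<omega> A_sets[of "Suc n"]] n by simp
      also have "fun_upd \<omega> n -` A (Suc n) \<inter> X = (if \<omega> \<in> A n then {w n} else {})"
        using \<omega> w[OF n] by (auto simp: A_def space_PiM PiE_iff extensional_def split: if_splits)
      also have "emeasure (?P n \<omega>) \<dots> = emeasure (?P n w) {w n} * indicator (A n) \<omega>"
        by (cases n) (auto simp: A_def PiE_iff)
      finally show "emeasure (IT.eP n \<omega>) (A (Suc n)) = emeasure (?P n w) {w n} * indicator (A n) \<omega>" .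
    qed
    also have "\<dots> = emeasure (IT.C 0 n u) (A n) * emeasure (?P n w) {w n}"
      using A_sets[of n] n IT.sets_C[OF u, of n] by (subst nn_integral_cmult_indicator) (simp_all add: mult.commute)
    finally show ?thesis .
  qed
  have C: "emeasure (IT.C 0 (Suc n) u) (A (Suc n)) =
      indicator {x} (w 0) * (\<Prod>s<n. emeasure (K s (w s)) {w (Suc s)})" if "n \<le> t" for n
    using that
  proof (induction n)
    case 0
    have "emeasure (IT.C 0 0 u) (A 0) = 1"
      using A_sets[of 0] by (simp add: A_def u_def)
    then show ?case
      using step[of 0] w[of 0] by (simp del: IT.C.simps add: indicator_def)
  next
    case (Suc n)
    then show ?case
      using step[of "Suc n"] by (simp del: IT.C.simps add: mult.assoc)
  qed
  have sp: "space (path_law X x K) = space (PiM UNIV ?M)"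
    unfolding path_law_def by simp
  have "{\<omega> \<in> space (path_law X x K). \<forall>s\<le>t. \<omega> s = w s} = prod_emb UNIV ?M {0..<Suc t} (A (Suc t))"
    unfolding sp by (auto simp: prod_emb_def A_def space_PiM PiE_iff less_Suc_eq_le)
  then have "emeasure (path_law X x K) {\<omega> \<in> space (path_law X x K). \<forall>s\<le>t. \<omega> s = w s} =
      emeasure (IT.CI {0..<Suc t}) (A (Suc t))"
    using IT.lim[OF _ A_sets[of "Suc t"]] by (simp add: path_law_def)
  also have "\<dots> = emeasure (IT.C 0 (Suc t) u) (A (Suc t))"
    using IT.emeasure_CI[OF subset_refl A_sets[of "Suc t"]] A_sets[of "Suc t", THEN sets.sets_into_space]
    by (simp add: u_def prod_emb_id space_PiM del: IT.C.simps)
  finally show ?thesis using C[of t] by simp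
qed

text \<open>Values are taken in the extended reals, so that suprema and infima are the usual ones and
  \<open>\<inf>{} = \<infinity>\<close> if there is no admissible kernel.\<close>

definition robust_value ::
  "real \<Rightarrow> ('a \<Rightarrow> 'b \<Rightarrow> 'a \<Rightarrow> real) \<Rightarrow> 'a set \<Rightarrow> 'b set \<Rightarrow> ('a \<Rightarrow> 'b \<Rightarrow> 'a measure set) \<Rightarrow> 'a \<Rightarrow> ereal"
  where "robust_value \<alpha> r X A R x =
    (SUP a\<in>policies X A. INF P\<in>path_law X x ` admissible_kernels X R a.
       ereal (\<integral>\<omega>. (\<Sum>t. \<alpha> ^ t * r (\<omega> t) (a t (\<omega> t)) (\<omega> (Suc t))) \<partial>P))"

text \<open>The largest difference quotient of \<open>f\<close> on \<open>X\<close>. Inserting \<open>0\<close> only matters if \<open>X\<close> is a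
  singleton, where there is no pair \<open>y \<noteq> y'\<close>. Since \<open>\<infinity> - \<infinity> = \<infinity>\<close> in \<^typ>\<open>ereal\<close>, an infinite value
  of \<open>f\<close> makes the slope infinite if \<open>X\<close> has at least two points.\<close>

definition max_slope :: "'a::real_normed_vector set \<Rightarrow> ('a \<Rightarrow> ereal) \<Rightarrow> ereal"
  where "max_slope X f =
    Max (insert 0 ((\<lambda>(y, y'). \<bar>f y - f y'\<bar> / ereal (norm (y - y'))) ` {(y, y'). y \<in> X \<and> y' \<in> X \<and> y \<noteq> y'}))"

end

theory Submission
  imports Defs
begin

text \<open>On a finite space couplings are transport plans, i.e. nonnegative matrices with prescribed
  marginals. A law is rounded to the grid by moving mass at most \<open>|X| / (2 n)\<close>, which changes
  \<open>W\<^sub>q\<^sup>q\<close> by at most \<open>D ^ q |X| / (2 n)\<close>, where \<open>D\<close> is the diameter. This gives (i). To stay in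
  the ball, the law is first mixed with the centre, with weight \<open>D ^ q |X| / (2 n \<epsilon> ^ q)\<close>; expectations
  of Lipschitz functions then change by \<open>O(1 / n)\<close>, with an explicit constant if \<open>q = 1\<close>. Robust
  values are fixed points of the robust Bellman operators, and since these are \<open>\<alpha>\<close>-contractions,
  a one-step error \<open>\<delta>\<close> for the function \<open>V\<close> gives a total error \<open>\<delta> / (1 - \<alpha>)\<close>.\<close>

section \<open>Transport plans on finite spaces\<close>

text \<open>The rounded law must lie in the ball with the same radius. After mixing with weight
  \<open>l\<close>, the admixed part of the centre is coupled with itself for free, so at most (1 -
  l) eps^q of the cost remains. The weight is the one for which the freed l eps^q equals the cost of
  rounding. Plans are modified directly, so that costs add in W_q^q. The triangle inequality for W_q
  would ask for a weight of order n^(-1/q), and its effect on expectations need not fit into the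
  constant C. With a weight of order 1/n, the total error is o(n^(-1/q)) for q >= 2. This and the
  condition l <= 1 are the origin of n0. For q = 1 there is no such slack, and the eps in the weight
  has to be cancelled by W_1(P, P0) <= eps. The other obstacle is that C contains the Lipschitz
  constant of V but none of V^(n). The two Bellman operators are therefore compared at V only. The
  opposite inequality costs nothing because the grid sets are contained in the balls.\<close>

lemma M1_finiteD:
  assumes "finite X" "P \<in> M1 X"
  shows sum_measure_M1: "(\<Sum>x\<in>X. measure P {x}) = 1"
    and integral_M1: "(\<integral>x. f x \<partial>P) = (\<Sum>x\<in>X. measure P {x} * (f x :: real))"
proof -
  have sets: "sets P = Pow X" and "prob_space P"
    using assms by (auto simp: space_prob_algebra)
  then interpret prob_space P by simp
  have space: "space P = X"
    using sets by (metis Pow_top sets.sets_into_space sets.top Pow_iff subset_antisym)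
  have "measure P X = (\<Sum>x\<in>X. measure P {x})"
    using assms sets by (intro measure_eq_sum_singleton) auto
  then show "(\<Sum>x\<in>X. measure P {x}) = 1"
    using prob_space space by simp
  have "(\<integral>x. f x \<partial>P) = (\<integral>x. (\<Sum>z\<in>X. indicator {z} x * f z) \<partial>P)"
    using assms by (intro Bochner_Integration.integral_cong) (auto simp: space indicator_def sum.If_cases if_distrib[of "\<lambda>u. u * _"])
  also have "\<dots> = (\<Sum>z\<in>X. measure P {z} * f z)"
    using sets by (subst Bochner_Integration.integral_sum) (auto simp: space less_top[symmetric] intro!: integrable_mult_left integrable_real_indicator)
  finally show "(\<integral>x. f x \<partial>P) = (\<Sum>x\<in>X. measure P {x} * f x)" .
qed

lemma ex_M1:
  assumes "finite X" "\<And>x. x \<in> X \<Longrightarrow> 0 \<le> p x" "sum p X = 1"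
  shows "\<exists>P\<in>M1 X. \<forall>x\<in>X. measure P {x} = p x"
proof (intro bexI ballI)
  let ?P = "point_measure X (\<lambda>x. ennreal (p x))"
  show "measure ?P {x} = p x" if "x \<in> X" for x
    using assms that by (simp add: measure_def emeasure_point_measure_finite)
  show "?P \<in> M1 X"
    using assms by (auto simp: space_prob_algebra sets_point_measure space_point_measure
        emeasure_point_measure_finite sum_ennreal intro!: prob_spaceI)
qed

lemma M1_eqI:
  assumes "finite X" "P \<in> M1 X" "Q \<in> M1 X" "\<And>x. x \<in> X \<Longrightarrow> measure P {x} = measure Q {x}"
  shows "P = Q"
proof (rule measure_eqI_finite)
  show "sets P = Pow X" "sets Q = Pow X" "finite X"
    using assms by (auto simp: space_prob_algebra)
  have "finite_measure P" "finite_measure Q"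
    using assms by (auto simp: space_prob_algebra prob_space.finite_measure)
  then show "emeasure P {x} = emeasure Q {x}" if "x \<in> X" for x
    using assms(4)[OF that] by (simp add: finite_measure.emeasure_eq_measure)
qed

text \<open>Real matrices replace measures on \<open>X \<times> X\<close>, so that plans can be
  scaled, added and changed entrywise without constructing a measure each time.\<close>

definition transport_plans :: "'a set \<Rightarrow> ('a \<Rightarrow> real) \<Rightarrow> ('a \<Rightarrow> real) \<Rightarrow> ('a \<Rightarrow> 'a \<Rightarrow> real) set"
  where "transport_plans X p s =
    {c. (\<forall>x\<in>X. \<forall>y\<in>X. 0 \<le> c x y) \<and> (\<forall>x\<in>X. (\<Sum>y\<in>X. c x y) = p x) \<and> (\<forall>y\<in>X. (\<Sum>x\<in>X. c x y) = s y)}"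

definition transport_cost :: "'a::real_normed_vector set \<Rightarrow> nat \<Rightarrow> ('a \<Rightarrow> 'a \<Rightarrow> real) \<Rightarrow> real"
  where "transport_cost X q c = (\<Sum>x\<in>X. \<Sum>y\<in>X. c x y * norm (x - y) ^ q)"

lemma transport_cost_nonneg: "c \<in> transport_plans X p s \<Longrightarrow> 0 \<le> transport_cost X q c"
  by (auto simp: transport_plans_def transport_cost_def intro!: sum_nonneg)

text \<open>For finite \<open>X\<close> the product sigma-algebra is the full power set, and laws on
  \<open>X\<close> agree as soon as they agree on singletons. Equality of the image measures is thus
  equality of row and column sums.\<close>

lemma couplings_finite:
  assumes "finite X" "P \<in> M1 X" "Q \<in> M1 X"
  shows "\<pi> \<in> couplings X P Q \<longleftrightarrow>
    \<pi> \<in> M1 (X \<times> X) \<and> (\<lambda>x y. measure \<pi> {(x, y)}) \<in> transport_plans X (\<lambda>x. measure P {x}) (\<lambda>x. measure Q {x})"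
proof -
  have pair: "count_space X \<Otimes>\<^sub>M count_space X = count_space (X \<times> X)"
    using assms(1) by (simp add: pair_measure_count_space)
  have "distr \<pi> (count_space X) fst = P \<and> distr \<pi> (count_space X) snd = Q \<longleftrightarrow>
      (\<forall>x\<in>X. (\<Sum>y\<in>X. measure \<pi> {(x, y)}) = measure P {x}) \<and> (\<forall>y\<in>X. (\<Sum>x\<in>X. measure \<pi> {(x, y)}) = measure Q {y})"
    if \<pi>: "\<pi> \<in> M1 (X \<times> X)"
  proof -
    have sets: "sets \<pi> = Pow (X \<times> X)" and "prob_space \<pi>"
      using \<pi> by (auto simp: space_prob_algebra)
    then interpret \<pi>: prob_space \<pi> by simp
    have space: "space \<pi> = X \<times> X"
      using sets by (metis Pow_top sets.sets_into_space sets.top Pow_iff subset_antisym)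
    have m: "fst \<in> measurable \<pi> (count_space X)" "snd \<in> measurable \<pi> (count_space X)"
      using sets space by (auto simp: measurable_def)
    then have d: "distr \<pi> (count_space X) fst \<in> M1 X" "distr \<pi> (count_space X) snd \<in> M1 X"
      by (auto simp: space_prob_algebra intro: \<pi>.prob_space_distr)
    have "measure (distr \<pi> (count_space X) fst) {x} = (\<Sum>y\<in>X. measure \<pi> {(x, y)})" if "x \<in> X" for x
    proof -
      have "measure (distr \<pi> (count_space X) fst) {x} = measure \<pi> (Pair x ` X)"
        using that m by (subst measure_distr) (auto simp: space intro!: arg_cong[where f="measure \<pi>"])
      also have "\<dots> = (\<Sum>z\<in>Pair x ` X. measure \<pi> {z})"
        using that assms(1) sets by (intro \<pi>.finite_measure_eq_sum_singleton) auto
      finally show ?thesis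
        by (simp add: sum.reindex inj_on_def)
    qed
    moreover have "measure (distr \<pi> (count_space X) snd) {y} = (\<Sum>x\<in>X. measure \<pi> {(x, y)})" if "y \<in> X" for y
    proof -
      have "measure (distr \<pi> (count_space X) snd) {y} = measure \<pi> ((\<lambda>x. (x, y)) ` X)"
        using that m by (subst measure_distr) (auto simp: space intro!: arg_cong[where f="measure \<pi>"])
      also have "\<dots> = (\<Sum>z\<in>(\<lambda>x. (x, y)) ` X. measure \<pi> {z})"
        using that assms(1) sets by (intro \<pi>.finite_measure_eq_sum_singleton) auto
      finally show ?thesis
        by (simp add: sum.reindex inj_on_def)
    qed
    ultimately show ?thesis
      using M1_eqI[OF assms(1) d(1) assms(2)] M1_eqI[OF assms(1) d(2) assms(3)] by metis
  qed
  then show ?thesis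
    unfolding couplings_def pair transport_plans_def by auto
qed

definition optimal_cost ::
  "'a::real_normed_vector set \<Rightarrow> nat \<Rightarrow> ('a \<Rightarrow> real) \<Rightarrow> ('a \<Rightarrow> real) \<Rightarrow> real"
  where "optimal_cost X q p s = (INF c\<in>transport_plans X p s. transport_cost X q c)"

text \<open>Plans are unconstrained off \<open>X\<close>, so they do not correspond one to one to
  couplings. What coincides, and is all that the infimum sees, is the set of attained costs.\<close>

lemma wasserstein_finite:
  assumes "finite X" "P \<in> M1 X" "Q \<in> M1 X"
  shows "wasserstein X q P Q =
    optimal_cost X q (\<lambda>x. measure P {x}) (\<lambda>x. measure Q {x}) powr (1 / real q)"
proof -
  let ?T = "transport_plans X (\<lambda>x. measure P {x}) (\<lambda>x. measure Q {x})"
  have int: "(\<integral>(x, y). norm (x - y) ^ q \<partial>\<pi>) = transport_cost X q (\<lambda>x y. measure \<pi> {(x, y)})"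
    if "\<pi> \<in> M1 (X \<times> X)" for \<pi>
    using assms(1) integral_M1[OF _ that, of "\<lambda>(x, y). norm (x - y) ^ q"]
    by (simp add: transport_cost_def sum.cartesian_product split_def)
  have "(\<lambda>\<pi>. \<integral>(x, y). norm (x - y) ^ q \<partial>\<pi>) ` couplings X P Q = transport_cost X q ` ?T"
  proof (intro equalityI subsetI)
    fix v assume "v \<in> (\<lambda>\<pi>. \<integral>(x, y). norm (x - y) ^ q \<partial>\<pi>) ` couplings X P Q"
    then show "v \<in> transport_cost X q ` ?T"
      using int couplings_finite[OF assms] by auto
  next
    fix v assume "v \<in> transport_cost X q ` ?T"
    then obtain c where c: "c \<in> ?T" "v = transport_cost X q c"
      by auto
    have "(\<Sum>z\<in>X \<times> X. case z of (x, y) \<Rightarrow> c x y) = 1"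
      using c sum_measure_M1[OF assms(1,2)]
      by (simp add: transport_plans_def flip: sum.cartesian_product)
    then obtain \<pi> where \<pi>: "\<pi> \<in> M1 (X \<times> X)" "\<And>x y. x \<in> X \<Longrightarrow> y \<in> X \<Longrightarrow> measure \<pi> {(x, y)} = c x y"
      using ex_M1[of "X \<times> X" "\<lambda>(x, y). c x y"] assms(1) c by (auto simp: transport_plans_def)
    then have "\<pi> \<in> couplings X P Q"
      using couplings_finite[OF assms] c by (auto simp: transport_plans_def)
    moreover have "v = (\<integral>(x, y). norm (x - y) ^ q \<partial>\<pi>)"
      using c \<pi> by (simp add: int transport_cost_def)
    ultimately show "v \<in> (\<lambda>\<pi>. \<integral>(x, y). norm (x - y) ^ q \<partial>\<pi>) ` couplings X P Q"
      by auto
  qed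
  then show ?thesis
    by (simp add: wasserstein_def optimal_cost_def)
qed

lemma optimal_cost_le: "c \<in> transport_plans X p s \<Longrightarrow> optimal_cost X q p s \<le> transport_cost X q c"
  unfolding optimal_cost_def by (intro cINF_lower bdd_belowI2[of _ 0] transport_cost_nonneg)

lemma transport_plans_nonempty:
  assumes "\<And>x. x \<in> X \<Longrightarrow> 0 \<le> p x" "\<And>x. x \<in> X \<Longrightarrow> 0 \<le> s x" "sum p X = 1" "sum s X = 1"
  shows "transport_plans X p s \<noteq> {}"
proof -
  have "(\<lambda>x y. p x * s y) \<in> transport_plans X p s"
    using assms by (simp add: transport_plans_def flip: sum_distrib_left sum_distrib_right)
  then show ?thesis by auto
qed

text \<open>Stands in for the existence of an optimal plan: an affine estimate valid for every plan
  passes to the infimum. The slope \<open>k = 0\<close> is treated apart because the proof divides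
  by \<open>k\<close>; it occurs for the slope \<open>1 - l\<close> when
  \<open>l = 1\<close>.\<close>

lemma le_optimal_cost:
  assumes "transport_plans X p s \<noteq> {}" "0 \<le> k"
    and "\<And>c. c \<in> transport_plans X p s \<Longrightarrow> a \<le> k * transport_cost X q c + b"
  shows "a \<le> k * optimal_cost X q p s + b"
proof (cases "k = 0")
  case True
  then show ?thesis using assms by auto
next
  case False
  then have "(a - b) / k \<le> transport_cost X q c" if "c \<in> transport_plans X p s" for c
    using assms(3)[OF that] assms(2) by (simp add: field_simps)
  then have "(a - b) / k \<le> optimal_cost X q p s"
    unfolding optimal_cost_def using assms(1) by (intro cINF_greatest)
  then show ?thesis
    using False assms(2) by (simp add: field_simps)
qed

lemma optimal_cost_nonneg: "transport_plans X p s \<noteq> {} \<Longrightarrow> 0 \<le> optimal_cost X q p s"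
  using le_optimal_cost[of X p s 1 0 q 0] transport_cost_nonneg[of _ X p s q] by simp

text \<open>Removes the root, so that membership in the ball becomes a bound on a cost that is
  linear in the plan.\<close>

lemma wasserstein_le_iff:
  assumes "finite X" "P \<in> M1 X" "Q \<in> M1 X" "0 \<le> e" "1 \<le> q"
  shows "wasserstein X q P Q \<le> e \<longleftrightarrow> optimal_cost X q (\<lambda>x. measure P {x}) (\<lambda>x. measure Q {x}) \<le> e ^ q"
proof -
  let ?w = "optimal_cost X q (\<lambda>x. measure P {x}) (\<lambda>x. measure Q {x})"
  have w: "0 \<le> ?w"
    using assms by (intro optimal_cost_nonneg transport_plans_nonempty) (auto simp: sum_measure_M1)
  have "e = (e ^ q) powr (1 / q)"
    using assms by (cases "e = 0") (auto simp: powr_powr powr_realpow[symmetric])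
  then have "?w powr (1 / q) \<le> e \<longleftrightarrow> ?w powr (1 / q) \<le> (e ^ q) powr (1 / q)"
    by simp
  also have "\<dots> \<longleftrightarrow> ?w \<le> e ^ q"
    using w assms powr_mono2[of "1 / real q" ?w "e ^ q"] powr_less_mono2[of "1 / real q" "e ^ q" ?w]
    by (auto simp flip: not_less)
  finally show ?thesis
    by (simp add: wasserstein_finite[OF assms(1-3)])
qed

section \<open>Constructions of plans: staying in place, mixing, moving mass\<close>

lemma diagonal_plan:
  assumes "finite X" "\<And>x. x \<in> X \<Longrightarrow> 0 \<le> p x" "1 \<le> q"
  shows "(\<lambda>x y. if x = y then p x else 0) \<in> transport_plans X p p"
    and "transport_cost X q (\<lambda>x y. if x = y then p x else 0) = 0"
  \<comment> \<open>\<open>1 \<le> q\<close> enters the cost on the diagonal, since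
    \<open>0 ^ 0 = 1\<close>.\<close>
  using assms by (auto simp: transport_plans_def transport_cost_def sum.delta sum.delta' intro!: sum.neutral)

text \<open>The share \<open>l * s\<close> is common to both marginals and stays in place at no
  cost; only the remaining share \<open>1 - l\<close> is transported, along
  \<open>c\<close>.\<close>

lemma mixed_plan:
  assumes "finite X" "\<And>x. x \<in> X \<Longrightarrow> 0 \<le> s x" "1 \<le> q" "0 \<le> l" "l \<le> 1"
    and c: "c \<in> transport_plans X p s"
  shows "\<exists>c'\<in>transport_plans X (\<lambda>x. (1 - l) * p x + l * s x) s.
    transport_cost X q c' = (1 - l) * transport_cost X q c"
proof (intro bexI)
  let ?d = "\<lambda>x y. if x = y then s x else 0"
  let ?c = "\<lambda>x y. (1 - l) * c x y + l * ?d x y"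
  have d: "?d \<in> transport_plans X s s" "transport_cost X q ?d = 0"
    using diagonal_plan[of X s q] assms by auto
  show "?c \<in> transport_plans X (\<lambda>x. (1 - l) * p x + l * s x) s"
    unfolding transport_plans_def mem_Collect_eq sum.distrib sum_distrib_left[symmetric]
  proof (intro conjI ballI)
    show "0 \<le> ?c x y" if "x \<in> X" "y \<in> X" for x y
      using c assms that by (auto simp: transport_plans_def intro!: add_nonneg_nonneg mult_nonneg_nonneg)
    show "(1 - l) * (\<Sum>y\<in>X. c x y) + l * (\<Sum>y\<in>X. ?d x y) = (1 - l) * p x + l * s x" if "x \<in> X" for x
      using c d(1) that by (simp add: transport_plans_def)
    show "(1 - l) * (\<Sum>x\<in>X. c x y) + l * (\<Sum>x\<in>X. ?d x y) = s y" if "y \<in> X" for y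
      using c d(1) that by (simp add: transport_plans_def left_diff_distrib)
  qed
  show "transport_cost X q ?c = (1 - l) * transport_cost X q c"
    using d(2) unfolding transport_cost_def
    by (simp add: sum.distrib distrib_right mult.assoc flip: sum_distrib_left)
qed

text \<open>For probability vectors this is the total variation distance: as the total masses agree,
  the mass lost equals the mass gained, and one side is enough.\<close>

definition excess :: "'a set \<Rightarrow> ('a \<Rightarrow> real) \<Rightarrow> ('a \<Rightarrow> real) \<Rightarrow> real"
  where "excess X p p' = (\<Sum>x\<in>X. max 0 (p x - p' x))"

text \<open>The mass that \<open>p\<close> loses is removed proportionally from the rows of the plan, and the mass
  \<open>p'\<close> gains is shipped to the resulting deficits by an independent coupling.\<close>

lemma moved_plan:
  assumes fin: "finite X" and c: "c \<in> transport_plans X p s"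
    and p: "\<And>x. x \<in> X \<Longrightarrow> 0 \<le> p x" "sum p X = 1" and p': "\<And>x. x \<in> X \<Longrightarrow> 0 \<le> p' x" "sum p' X = 1"
    and D: "\<And>x y. x \<in> X \<Longrightarrow> y \<in> X \<Longrightarrow> norm (x - y) \<le> D"
  shows "\<exists>c'\<in>transport_plans X p' s. transport_cost X q c' \<le> transport_cost X q c + D ^ q * excess X p p'"
proof -
  define \<tau> where "\<tau> = excess X p p'"
  \<comment> \<open>\<open>h x\<close> is the kept fraction of row \<open>x\<close>,
    \<open>e x\<close> the mass gained at \<open>x\<close>, and \<open>f y\<close> the mass now
    missing in column \<open>y\<close>; \<open>e\<close> and \<open>f\<close> both have total
    \<open>\<tau>\<close>. If \<open>p x = 0\<close>, division by zero gives \<open>h x = 0\<close>,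
    which is consistent with \<open>p x * h x = min (p x) (p' x)\<close>.\<close>
  define h where "h x = min (p x) (p' x) / p x" for x
  define e where "e x = p' x - min (p x) (p' x)" for x
  define f where "f y = (\<Sum>x\<in>X. c x y * (1 - h x))" for y
  define c' where "c' x y = c x y * h x + e x * f y / \<tau>" for x y
  have c0: "0 \<le> c x y" and row: "(\<Sum>y\<in>X. c x y) = p x" and col: "(\<Sum>x\<in>X. c x y) = s y"
    if "x \<in> X" "y \<in> X" for x y
    using c that by (auto simp: transport_plans_def)
  have h: "0 \<le> h x" "h x \<le> 1" "p x * h x = min (p x) (p' x)" if "x \<in> X" for x
    using p(1)[OF that] p'(1)[OF that] by (auto simp: h_def divide_simps)
  have e0: "0 \<le> e x" for x
    by (simp add: e_def)
  have f0: "0 \<le> f y" if "y \<in> X" for y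
    unfolding f_def using c0 h that by (intro sum_nonneg mult_nonneg_nonneg) auto
  have \<tau>: "\<tau> = (\<Sum>x\<in>X. p x - min (p x) (p' x))"
    unfolding \<tau>_def excess_def by (intro sum.cong) auto
  have sum_e: "sum e X = \<tau>"
    using p p' unfolding \<tau> e_def by (simp add: sum_subtractf)
  have sum_f: "sum f X = \<tau>"
  proof -
    have "sum f X = (\<Sum>x\<in>X. \<Sum>y\<in>X. c x y * (1 - h x))"
      unfolding f_def by (rule sum.swap)
    also have "\<dots> = (\<Sum>x\<in>X. p x * (1 - h x))"
      using row by (intro sum.cong) (auto simp flip: sum_distrib_right)
    also have "\<dots> = \<tau>"
      unfolding \<tau> using h by (intro sum.cong) (auto simp: algebra_simps)
    finally show ?thesis .
  qed
  have "0 \<le> \<tau>"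
    unfolding \<tau>_def excess_def by (intro sum_nonneg) auto
  \<comment> \<open>For \<open>\<tau> = 0\<close> the nonnegative \<open>e\<close> and
    \<open>f\<close> have sum zero and vanish on \<open>X\<close>, so the default
    \<open>\<tau> / \<tau> = 0\<close> does no harm.\<close>
  have e\<tau>: "e x * (\<tau> / \<tau>) = e x" and f\<tau>: "f x * (\<tau> / \<tau>) = f x" if "x \<in> X" for x
    using that fin sum_e sum_f e0 f0 sum_nonneg_eq_0_iff[of X e] sum_nonneg_eq_0_iff[of X f] by auto
  have "c' \<in> transport_plans X p' s"
    unfolding transport_plans_def mem_Collect_eq
  proof (intro conjI ballI)
    show "0 \<le> c' x y" if "x \<in> X" "y \<in> X" for x y
      unfolding c'_def using that c0 h e0 f0 \<open>0 \<le> \<tau>\<close> by (intro add_nonneg_nonneg mult_nonneg_nonneg divide_nonneg_nonneg)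
    show "(\<Sum>y\<in>X. c' x y) = p' x" if "x \<in> X" for x
    proof -
      have "(\<Sum>y\<in>X. c' x y) = (\<Sum>y\<in>X. c x y) * h x + e x * (sum f X / \<tau>)"
        unfolding c'_def by (simp add: sum.distrib sum_distrib_right sum_distrib_left sum_divide_distrib)
      also have "\<dots> = p' x"
        using row[OF that that] e\<tau>[OF that] h[OF that] by (simp only: sum_f e_def)
      finally show ?thesis .
    qed
    show "(\<Sum>x\<in>X. c' x y) = s y" if "y \<in> X" for y
    proof -
      have "(\<Sum>x\<in>X. c' x y) = (\<Sum>x\<in>X. c x y * h x) + f y * (sum e X / \<tau>)"
        unfolding c'_def by (simp add: sum.distrib sum_distrib_right sum_distrib_left sum_divide_distrib mult.commute)
      also have "\<dots> = (\<Sum>x\<in>X. c x y)"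
        unfolding sum_e f\<tau>[OF that] by (simp add: f_def right_diff_distrib sum_subtractf)
      finally show ?thesis
        using col[OF that that] by simp
    qed
  qed
  moreover have "transport_cost X q c' \<le> transport_cost X q c + D ^ q * \<tau>"
  proof -
    have "transport_cost X q c' \<le> (\<Sum>x\<in>X. \<Sum>y\<in>X. c x y * norm (x - y) ^ q + e x * f y / \<tau> * D ^ q)"
      unfolding transport_cost_def c'_def
    proof (intro sum_mono)
      fix x y assume xy: "x \<in> X" "y \<in> X"
      have "c x y * h x \<le> c x y"
        using c0[OF xy] h[OF xy(1)] by (simp add: mult_left_le)
      moreover have "e x * f y / \<tau> * norm (x - y) ^ q \<le> e x * f y / \<tau> * D ^ q"
        using e0 f0 \<open>0 \<le> \<tau>\<close> D xy by (intro mult_left_mono power_mono) auto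
      ultimately show "(c x y * h x + e x * f y / \<tau>) * norm (x - y) ^ q \<le>
          c x y * norm (x - y) ^ q + e x * f y / \<tau> * D ^ q"
        by (simp add: distrib_right add_mono mult_right_mono)
    qed
    also have "\<dots> = transport_cost X q c + (\<Sum>x\<in>X. e x * (sum f X / \<tau>)) * D ^ q"
      unfolding transport_cost_def
      by (simp add: sum.distrib sum_distrib_right sum_distrib_left sum_divide_distrib)
    also have "(\<Sum>x\<in>X. e x * (sum f X / \<tau>)) = \<tau>"
      using e\<tau> sum_e by (simp add: sum_f)
    finally show ?thesis
      by (simp add: mult.commute)
  qed
  ultimately show ?thesis
    unfolding \<tau>_def by blast
qed

text \<open>The easy half of Kantorovich-Rubinstein duality: the difference of the two means is the
  sum of \<open>f x - f y\<close> against the plan.\<close>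

lemma transport_difference_le:
  assumes c: "c \<in> transport_plans X p s"
    and L: "\<And>x y. x \<in> X \<Longrightarrow> y \<in> X \<Longrightarrow> \<bar>f x - f y\<bar> \<le> L * norm (x - y)"
  shows "(\<Sum>x\<in>X. p x * f x) - (\<Sum>x\<in>X. s x * f x) \<le> L * transport_cost X 1 c"
proof -
  have c0: "0 \<le> c x y" if "x \<in> X" "y \<in> X" for x y
    using c that by (auto simp: transport_plans_def)
  have "(\<Sum>x\<in>X. p x * f x) = (\<Sum>x\<in>X. \<Sum>y\<in>X. c x y * f x)"
    using c by (simp add: transport_plans_def flip: sum_distrib_right)
  moreover have "(\<Sum>y\<in>X. s y * f y) = (\<Sum>x\<in>X. \<Sum>y\<in>X. c x y * f y)"
    using c by (subst sum.swap) (simp add: transport_plans_def flip: sum_distrib_right)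
  ultimately have "(\<Sum>x\<in>X. p x * f x) - (\<Sum>x\<in>X. s x * f x) = (\<Sum>x\<in>X. \<Sum>y\<in>X. c x y * (f x - f y))"
    by (simp add: sum_subtractf right_diff_distrib)
  also have "\<dots> \<le> (\<Sum>x\<in>X. \<Sum>y\<in>X. c x y * (L * norm (x - y)))"
    using c0 L by (intro sum_mono mult_left_mono) (auto simp: abs_le_iff)
  also have "\<dots> = L * transport_cost X 1 c"
    by (simp add: transport_cost_def sum_distrib_left ac_simps)
  finally show ?thesis .
qed

section \<open>Rounding probability vectors to multiples of 1/n\<close>

lemma ex_rounding:
  fixes p :: "'a \<Rightarrow> real"
  assumes "finite X" "\<And>x. x \<in> X \<Longrightarrow> 0 \<le> p x" "sum p X = real n"
  shows "\<exists>k. sum k X = n \<and> (\<forall>x\<in>X. \<bar>p x - real (k x)\<bar> \<le> 1)"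
proof -
  define fl where "fl x = nat \<lfloor>p x\<rfloor>" for x
  have fl: "real (fl x) \<le> p x" "p x < real (fl x) + 1" if "x \<in> X" for x
    using assms(2)[OF that] unfolding fl_def by linarith+
  have "real (sum fl X) \<le> real n"
    unfolding assms(3)[symmetric] of_nat_sum using fl by (intro sum_mono) auto
  then have le: "sum fl X \<le> n"
    by (simp del: of_nat_sum)
  have "real n \<le> (\<Sum>x\<in>X. real (fl x) + 1)"
    unfolding assms(3)[symmetric] using fl by (intro sum_mono) (auto simp: less_imp_le)
  also have "\<dots> = real (sum fl X + card X)"
    by (simp add: sum.distrib)
  finally have "n - sum fl X \<le> card X"
    by linarith
  \<comment> \<open>Rounding down loses less than one unit per point, so the integer deficit is at
    most \<open>card X\<close> and can be repaid by one unit at each point of a set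
    \<open>S\<close>. The deviation then lies between -1 and 1.\<close>
  then obtain S where S: "S \<subseteq> X" "card S = n - sum fl X"
    by (meson obtain_subset_with_card_n)
  let ?k = "\<lambda>x. fl x + (if x \<in> S then 1 else 0)"
  have "sum ?k X = sum fl X + card S"
    using S assms(1) by (simp add: sum.distrib sum.If_cases Int_absorb1)
  then show ?thesis
    using S le fl by (intro exI[of _ ?k]) (fastforce simp: abs_le_iff)
qed

lemma ex_grid_measure:
  assumes fin: "finite X" and p: "\<And>x. x \<in> X \<Longrightarrow> 0 \<le> p x" "sum p X = 1" and n: "1 \<le> n"
  shows "\<exists>P'\<in>grid_measures X n. excess X p (\<lambda>x. measure P' {x}) \<le> real (card X) / (2 * real n)"
proof -
  obtain k where k: "sum k X = n" "\<And>x. x \<in> X \<Longrightarrow> \<bar>real n * p x - real (k x)\<bar> \<le> 1"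
    using ex_rounding[of X "\<lambda>x. real n * p x" n] assms by (auto simp flip: sum_distrib_left)
  have kn: "k x \<le> n" if "x \<in> X" for x
    using member_le_sum[OF that, of k] fin k(1) by simp
  have "(\<Sum>x\<in>X. real (k x) / real n) = 1"
    using k(1) n by (simp flip: sum_divide_distrib of_nat_sum)
  then obtain P' where P': "P' \<in> M1 X" "\<And>x. x \<in> X \<Longrightarrow> measure P' {x} = real (k x) / real n"
    using ex_M1[OF fin, of "\<lambda>x. real (k x) / real n"] by auto
  then have "P' \<in> grid_measures X n"
    using kn by (auto simp: grid_measures_def)
  \<comment> \<open>\<open>2 * max 0 u = \<bar>u\<bar> + u\<close>, and the linear terms cancel
    because both laws have mass one. The resulting factor 1/2 is what lets mixing and rounding share
    the available error when \<open>q = 1\<close>.\<close>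
  have "2 * excess X p (\<lambda>x. measure P' {x}) =
      (\<Sum>x\<in>X. \<bar>p x - real (k x) / real n\<bar> + (p x - real (k x) / real n))"
    unfolding excess_def sum_distrib_left using P' by (intro sum.cong) (auto simp: max_def)
  also have "\<dots> = (\<Sum>x\<in>X. \<bar>p x - real (k x) / real n\<bar>)"
    using p(2) \<open>(\<Sum>x\<in>X. real (k x) / real n) = 1\<close> by (simp add: sum.distrib sum_subtractf)
  also have "\<dots> \<le> (\<Sum>x\<in>X. 1 / real n)"
  proof (intro sum_mono)
    fix x assume "x \<in> X"
    have "p x - real (k x) / real n = (real n * p x - real (k x)) / real n"
      using n by (simp add: field_simps)
    then show "\<bar>p x - real (k x) / real n\<bar> \<le> 1 / real n"
      using k(2)[OF \<open>x \<in> X\<close>] by (simp add: abs_divide divide_right_mono)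
  qed
  also have "\<dots> = real (card X) / real n"
    by simp
  finally have "excess X p (\<lambda>x. measure P' {x}) \<le> real (card X) / (2 * real n)"
    by (simp add: field_simps)
  with \<open>P' \<in> grid_measures X n\<close> show ?thesis by auto
qed

section \<open>Robust Markov decision processes with finitely many states\<close>

lemma M1_integral_le:
  assumes "finite X" "P \<in> M1 X" "\<And>x. x \<in> X \<Longrightarrow> f x \<le> g x + c"
  shows "(\<integral>x. f x \<partial>P) \<le> (\<integral>x. g x \<partial>P) + (c :: real)"
proof -
  have "(\<Sum>x\<in>X. measure P {x} * f x) \<le> (\<Sum>x\<in>X. measure P {x} * (g x + c))"
    using assms(3) by (intro sum_mono mult_left_mono) auto
  then show ?thesis
    using assms sum_measure_M1[OF assms(1,2)]
    by (simp add: integral_M1 distrib_left sum.distrib flip: sum_distrib_right)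
qed

lemma finite_bound:
  fixes f :: "'a \<Rightarrow> real"
  assumes "finite X"
  shows "\<exists>B\<ge>0. \<forall>x\<in>X. \<bar>f x\<bar> \<le> B"
  using assms by (intro exI[of _ "\<Sum>x\<in>X. \<bar>f x\<bar>"]) (auto intro: sum_nonneg member_le_sum)

section \<open>Expectations along a time-inhomogeneous Markov chain with finitely many
  states\<close>

locale finite_markov_path =
  fixes X :: "'a set" and x :: 'a and K :: "nat \<Rightarrow> 'a \<Rightarrow> 'a measure"
  assumes finite_X: "finite X" and x: "x \<in> X" and K: "\<And>t y. y \<in> X \<Longrightarrow> K t y \<in> M1 X"
begin

abbreviation law :: "(nat \<Rightarrow> 'a) measure"
  where "law \<equiv> path_law X x K"

lemma sets_law: "sets law = sets (PiM UNIV (\<lambda>_. count_space X))"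
  and space_law: "space law = (\<Pi>\<^sub>E i\<in>UNIV. X)"
proof -
  interpret IT: Ionescu_Tulcea "step_kernel X x K" "\<lambda>_. count_space X"
    by (rule Ionescu_Tulcea_step_kernel[OF x K])
  show "sets law = sets (PiM UNIV (\<lambda>_. count_space X))" "space law = (\<Pi>\<^sub>E i\<in>UNIV. X)"
    by (simp_all add: path_law_def space_PiM)
qed

lemma prob_space_law: "prob_space law"
proof -
  let ?P = "step_kernel X x K" and ?M = "\<lambda>_::nat. count_space X"
  interpret IT: Ionescu_Tulcea ?P ?M
    by (rule Ionescu_Tulcea_step_kernel[OF x K])
  \<comment> \<open>The projection to the empty set of coordinates preserves total mass, and its law
    is the member of the projective family at the empty index set.\<close>
  have "prob_space (distr IT.PF.lim (PiM {} ?M) (\<lambda>\<omega>. restrict \<omega> {}))"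
    by (subst IT.distr_lim) (auto intro: IT.PF.prob_space_P)
  then have "prob_space IT.PF.lim"
    by (rule prob_space_distrD[rotated]) (simp add: measurable_cong_sets[OF IT.PF.sets_lim refl])
  then show ?thesis
    by (simp add: path_law_def)
qed

sublocale prob_space law
  by (rule prob_space_law)

lemma component_measurable[measurable]: "(\<lambda>\<omega>. \<omega> t) \<in> measurable law (count_space X)"
  unfolding measurable_cong_sets[OF sets_law refl] by simp

lemma component_in: "\<omega> \<in> space law \<Longrightarrow> \<omega> t \<in> X"
  by (auto simp: space_law)

definition cylinder :: "nat \<Rightarrow> (nat \<Rightarrow> 'a) \<Rightarrow> (nat \<Rightarrow> 'a) set"
  where "cylinder t w = {\<omega> \<in> space law. \<forall>s\<le>t. \<omega> s = w s}"

lemma component_event: "y \<in> X \<Longrightarrow> {\<omega> \<in> space law. \<omega> t = y} \<in> events"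
  using measurable_sets[OF component_measurable[of t], of "{y}"]
  by (auto simp: vimage_def Int_def conj_commute)

lemma cylinder_event:
  assumes "\<And>s. s \<le> t \<Longrightarrow> w s \<in> X"
  shows "cylinder t w \<in> events"
proof -
  have "cylinder t w = (\<Inter>s\<in>{..t}. {\<omega> \<in> space law. \<omega> s = w s})"
    by (auto simp: cylinder_def)
  also have "\<dots> \<in> events"
    using assms by (intro sets.finite_INT component_event) auto
  finally show ?thesis .
qed

lemma prob_cylinder_Suc:
  assumes "\<And>s. s \<le> Suc t \<Longrightarrow> w s \<in> X"
  shows "prob (cylinder (Suc t) w) = prob (cylinder t w) * measure (K t (w t)) {w (Suc t)}"
  using emeasure_path_law_cylinder[of x X K "Suc t" w] emeasure_path_law_cylinder[of x X K t w] x K assms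
  by (simp add: measure_def cylinder_def enn2real_mult mult.assoc)

definition marginal :: "nat \<Rightarrow> 'a \<Rightarrow> real"
  where "marginal t y = prob {\<omega> \<in> space law. \<omega> t = y}"

lemma marginal_nonneg: "0 \<le> marginal t y"
  by (simp add: marginal_def)

lemma marginal_0: "y \<in> X \<Longrightarrow> marginal 0 y = (if y = x then 1 else 0)"
  using emeasure_path_law_cylinder[of x X K 0 "\<lambda>_. y"] x K
  by (simp add: marginal_def measure_def)

lemma sum_marginal: "(\<Sum>y\<in>X. marginal t y) = 1"
proof -
  have "(\<Sum>y\<in>X. marginal t y) = prob (\<Union>y\<in>X. {\<omega> \<in> space law. \<omega> t = y})"
    unfolding marginal_def using finite_X component_event
    by (intro finite_measure_finite_Union[symmetric]) (auto simp: disjoint_family_on_def)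
  also have "(\<Union>y\<in>X. {\<omega> \<in> space law. \<omega> t = y}) = space law"
    using component_in by auto
  finally show ?thesis
    by (simp add: prob_space)
qed

text \<open>Split by the whole history up to time \<open>t\<close>. In each cylinder the last factor
  depends on the history only through its final state \<open>y\<close>, so it can be taken out of
  the sum.\<close>

lemma prob_transition:
  assumes y: "y \<in> X" and z: "z \<in> X"
  shows "prob {\<omega> \<in> space law. \<omega> t = y \<and> \<omega> (Suc t) = z} = marginal t y * measure (K t y) {z}"
proof -
  \<comment> \<open>Histories are extensional on \<open>{..t}\<close>: this makes them finite in
    number and gives disjoint cylinders for distinct histories.\<close>
  define W where "W = {w \<in> {..t} \<rightarrow>\<^sub>E X. w t = y}"
  have fin: "finite W"
    unfolding W_def using finite_X by (intro finite_subset[OF _ finite_PiE[of "{..t}" "\<lambda>_. X"]]) auto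
  have WX: "w s \<in> X" if "w \<in> W" "s \<le> t" for w s
    using that by (auto simp: W_def)
  have disj: "disjoint_family_on (\<lambda>w. cylinder t w) W"
    unfolding disjoint_family_on_def
  proof (intro ballI impI)
    fix v w assume "v \<in> W" "w \<in> W" "v \<noteq> w"
    then have "v = w" if "\<forall>s\<le>t. v s = w s"
      using that by (intro PiE_ext[of v "{..t}" "\<lambda>_. X" w]) (auto simp: W_def)
    with \<open>v \<noteq> w\<close> show "cylinder t v \<inter> cylinder t w = {}"
      by (auto simp: cylinder_def)
  qed
  have restr: "restrict \<omega> {..t} \<in> W" if "\<omega> \<in> space law" "\<omega> t = y" for \<omega>
    using that component_in by (auto simp: W_def)
  have "{\<omega> \<in> space law. \<omega> t = y} = (\<Union>w\<in>W. cylinder t w)"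
  proof (intro equalityI subsetI)
    fix \<omega> assume "\<omega> \<in> {\<omega> \<in> space law. \<omega> t = y}"
    then show "\<omega> \<in> (\<Union>w\<in>W. cylinder t w)"
      using restr by (intro UN_I[of "restrict \<omega> {..t}"]) (auto simp: cylinder_def)
  qed (auto simp: cylinder_def W_def)
  then have marg: "marginal t y = (\<Sum>w\<in>W. prob (cylinder t w))"
    unfolding marginal_def using fin disj WX cylinder_event
    by (simp, intro finite_measure_finite_Union) auto
  have upd: "cylinder (Suc t) (w(Suc t := z)) = {\<omega> \<in> cylinder t w. \<omega> (Suc t) = z}" for w
    by (auto simp: cylinder_def le_Suc_eq)
  have "{\<omega> \<in> space law. \<omega> t = y \<and> \<omega> (Suc t) = z} = {\<omega> \<in> space law. \<omega> t = y} \<inter> {\<omega>. \<omega> (Suc t) = z}"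
    by auto
  also have "\<dots> = (\<Union>w\<in>W. cylinder (Suc t) (w(Suc t := z)))"
    unfolding upd \<open>{\<omega> \<in> space law. \<omega> t = y} = (\<Union>w\<in>W. cylinder t w)\<close> by auto
  also have "prob \<dots> = (\<Sum>w\<in>W. prob (cylinder (Suc t) (w(Suc t := z))))"
  proof (rule finite_measure_finite_Union[OF fin])
    show "(\<lambda>w. cylinder (Suc t) (w(Suc t := z))) ` W \<subseteq> events"
      using WX z by (auto intro!: cylinder_event)
    show "disjoint_family_on (\<lambda>w. cylinder (Suc t) (w(Suc t := z))) W"
      using disj unfolding upd disjoint_family_on_def by auto
  qed
  also have "\<dots> = (\<Sum>w\<in>W. prob (cylinder t w) * measure (K t y) {z})"
  proof (rule sum.cong[OF refl])
    fix w assume w: "w \<in> W"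
    have "cylinder t (w(Suc t := z)) = cylinder t w"
      by (auto simp: cylinder_def)
    then show "prob (cylinder (Suc t) (w(Suc t := z))) = prob (cylinder t w) * measure (K t y) {z}"
      using prob_cylinder_Suc[of t "w(Suc t := z)"] w WX z by (auto simp: W_def)
  qed
  also have "\<dots> = marginal t y * measure (K t y) {z}"
    by (simp add: marg sum_distrib_right)
  finally show ?thesis .
qed

lemma expectation_transition:
  "expectation (\<lambda>\<omega>. f (\<omega> t) (\<omega> (Suc t)) :: real) = (\<Sum>y\<in>X. marginal t y * (\<integral>z. f y z \<partial>K t y))"
proof -
  let ?T = "\<lambda>\<omega>. (\<omega> t, \<omega> (Suc t))" and ?N = "count_space (X \<times> X)"
  have T: "?T \<in> measurable law ?N"
    unfolding pair_measure_count_space[OF finite_X finite_X, symmetric] by (intro measurable_Pair) auto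
  have M1: "distr law ?N ?T \<in> M1 (X \<times> X)"
    using T by (auto simp: space_prob_algebra intro: prob_space_distr)
  have "measure (distr law ?N ?T) {(y, z)} = marginal t y * measure (K t y) {z}" if "y \<in> X" "z \<in> X" for y z
  proof -
    have "?T -` {(y, z)} \<inter> space law = {\<omega> \<in> space law. \<omega> t = y \<and> \<omega> (Suc t) = z}"
      by auto
    then show ?thesis
      using that T prob_transition[OF that] by (simp add: measure_distr)
  qed
  moreover have "expectation (\<lambda>\<omega>. f (\<omega> t) (\<omega> (Suc t))) = (\<integral>u. (case u of (y, z) \<Rightarrow> f y z) \<partial>distr law ?N ?T)"
    using T by (subst integral_distr) auto
  ultimately have "expectation (\<lambda>\<omega>. f (\<omega> t) (\<omega> (Suc t))) =
      (\<Sum>y\<in>X. \<Sum>z\<in>X. marginal t y * measure (K t y) {z} * f y z)"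
    using finite_X unfolding sum.cartesian_product by (auto simp: integral_M1[OF _ M1] intro!: sum.cong)
  then show ?thesis
    by (simp add: integral_M1[OF finite_X K] sum_distrib_left mult.assoc)
qed

text \<open>The mean of \<open>g (\<omega> (Suc t))\<close> is computed twice by
  \<open>expectation_transition\<close>: as a function of the starting state of the transition at
  time \<open>Suc t\<close>, and of the end state of the transition at time
  \<open>t\<close>.\<close>

lemma marginal_Suc:
  "(\<Sum>z\<in>X. marginal (Suc t) z * g z) = (\<Sum>y\<in>X. marginal t y * (\<integral>z. g z \<partial>K t y))"
proof -
  have "expectation (\<lambda>\<omega>. g (\<omega> (Suc t))) = (\<Sum>z\<in>X. marginal (Suc t) z * (\<integral>u. g z \<partial>K (Suc t) z))"
    by (rule expectation_transition[of "\<lambda>y z. g y"])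
  also have "\<dots> = (\<Sum>z\<in>X. marginal (Suc t) z * g z)"
  proof (rule sum.cong[OF refl])
    fix z assume "z \<in> X"
    then show "marginal (Suc t) z * (\<integral>u. g z \<partial>K (Suc t) z) = marginal (Suc t) z * g z"
      using K[of z "Suc t"] by (simp add: space_prob_algebra prob_space.prob_space)
  qed
  finally show ?thesis
    using expectation_transition[of "\<lambda>y. g"] by simp
qed

text \<open>Verification identity for an arbitrary test function \<open>W\<close>: adding and
  subtracting the discounted means of \<open>W\<close> telescopes, so total reward minus
  \<open>W x\<close> becomes a discounted sum of mean one-step Bellman residuals.\<close>

lemma discounted_reward_sums:
  fixes \<rho> :: "nat \<Rightarrow> 'a \<Rightarrow> 'a \<Rightarrow> real"
  assumes \<alpha>: "0 \<le> \<alpha>" "\<alpha> < 1"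
    and B: "\<And>t y z. y \<in> X \<Longrightarrow> z \<in> X \<Longrightarrow> \<bar>\<rho> t y z\<bar> \<le> B"
  shows "(\<lambda>t. \<alpha> ^ t * (\<Sum>y\<in>X. marginal t y * ((\<integral>z. \<rho> t y z + \<alpha> * W z \<partial>K t y) - W y)))
    sums (expectation (\<lambda>\<omega>. \<Sum>t. \<alpha> ^ t * \<rho> t (\<omega> t) (\<omega> (Suc t))) - W x)"
proof -
  define u where "u t \<omega> = \<alpha> ^ t * \<rho> t (\<omega> t) (\<omega> (Suc t))" for t and \<omega> :: "nat \<Rightarrow> 'a"
  define v where "v t = (\<Sum>y\<in>X. marginal t y * W y)" for t
  have geom: "summable (\<lambda>t. \<alpha> ^ t * B)"
    using \<alpha> by (intro summable_mult2 summable_geometric) auto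
  have u_meas: "u t \<in> borel_measurable law" for t
  proof -
    have "(\<lambda>\<omega>. (\<omega> t, \<omega> (Suc t))) \<in> measurable law (count_space (X \<times> X))"
      unfolding pair_measure_count_space[OF finite_X finite_X, symmetric] by (intro measurable_Pair) auto
    then have "(\<lambda>\<omega>. case (\<omega> t, \<omega> (Suc t)) of (y, z) \<Rightarrow> \<alpha> ^ t * \<rho> t y z) \<in> borel_measurable law"
      by (rule measurable_compose) simp
    then show ?thesis by (simp add: u_def[abs_def])
  qed
  have u_le: "norm (u t \<omega>) \<le> \<alpha> ^ t * B" if "\<omega> \<in> space law" for t \<omega>
    using B[OF component_in[OF that] component_in[OF that]] \<alpha>
    by (auto simp: u_def abs_mult intro!: mult_left_mono)
  have u_int: "integrable law (u t)" for t
    using u_le u_meas by (intro integrable_const_bound[of _ "\<alpha> ^ t * B"]) auto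
  have norm_le: "expectation (\<lambda>\<omega>. norm (u t \<omega>)) \<le> \<alpha> ^ t * B" for t
    using u_le integrable_norm[OF u_int, of t] by (intro integral_le_const) auto
  have "summable (\<lambda>t. expectation (\<lambda>\<omega>. norm (u t \<omega>)))"
    using norm_le by (intro summable_comparison_test'[OF geom]) auto
  moreover have "AE \<omega> in law. summable (\<lambda>t. norm (u t \<omega>))"
    using u_le by (intro AE_I2 summable_comparison_test'[OF geom]) auto
  ultimately have "(\<lambda>t. expectation (u t)) sums expectation (\<lambda>\<omega>. \<Sum>t. u t \<omega>)"
    using u_int by (intro sums_integral)
  \<comment> \<open>\<open>W\<close> is bounded on \<open>X\<close>, hence the discounted means tend
    to 0 and only the term at time zero survives the telescoping.\<close>
  moreover have "(\<lambda>t. \<alpha> ^ t * v t - \<alpha> ^ Suc t * v (Suc t)) sums (\<alpha> ^ 0 * v 0 - 0)"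
  proof (rule telescope_sums')
    obtain B' where B': "\<forall>y\<in>X. \<bar>W y\<bar> \<le> B'"
      using finite_bound[OF finite_X] by blast
    have "\<bar>v t\<bar> \<le> B'" for t
    proof -
      have "\<bar>v t\<bar> \<le> (\<Sum>y\<in>X. marginal t y * B')"
        unfolding v_def using B' marginal_nonneg
        by (intro order_trans[OF sum_abs] sum_mono) (auto simp: abs_mult intro!: mult_left_mono)
      then show ?thesis
        by (simp add: sum_marginal flip: sum_distrib_right)
    qed
    then have "norm (\<alpha> ^ t * v t) \<le> \<alpha> ^ t * B'" for t
      using \<alpha> by (simp add: abs_mult mult_left_mono)
    moreover have "(\<lambda>t. \<alpha> ^ t * B') \<longlonglongrightarrow> 0"
      using \<alpha> by (intro tendsto_mult_left_zero LIMSEQ_power_zero) auto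
    ultimately show "(\<lambda>t. \<alpha> ^ t * v t) \<longlonglongrightarrow> 0"
      by (auto intro: Lim_null_comparison[where g="\<lambda>t. \<alpha> ^ t * B'"] always_eventually)
  qed
  ultimately have "(\<lambda>t. expectation (u t) - (\<alpha> ^ t * v t - \<alpha> ^ Suc t * v (Suc t)))
      sums (expectation (\<lambda>\<omega>. \<Sum>t. u t \<omega>) - (\<alpha> ^ 0 * v 0 - 0))"
    by (rule sums_diff)
  moreover have "expectation (u t) - (\<alpha> ^ t * v t - \<alpha> ^ Suc t * v (Suc t)) =
      \<alpha> ^ t * (\<Sum>y\<in>X. marginal t y * ((\<integral>z. \<rho> t y z + \<alpha> * W z \<partial>K t y) - W y))" for t
  proof -
    have E: "expectation (u t) = \<alpha> ^ t * (\<Sum>y\<in>X. marginal t y * (\<integral>z. \<rho> t y z \<partial>K t y))"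
      using expectation_transition[of "\<rho> t" t] by (simp add: u_def[abs_def])
    have v: "v (Suc t) = (\<Sum>y\<in>X. marginal t y * (\<integral>z. W z \<partial>K t y))"
      unfolding v_def by (rule marginal_Suc)
    have "(\<integral>z. \<rho> t y z + \<alpha> * W z \<partial>K t y) = (\<integral>z. \<rho> t y z \<partial>K t y) + \<alpha> * (\<integral>z. W z \<partial>K t y)"
      if "y \<in> X" for y
      using integral_M1[OF finite_X K[OF that]]
      by (simp add: distrib_left sum.distrib sum_distrib_left ac_simps)
    then have residual: "(\<Sum>y\<in>X. marginal t y * ((\<integral>z. \<rho> t y z + \<alpha> * W z \<partial>K t y) - W y)) =
        (\<Sum>y\<in>X. marginal t y * (\<integral>z. \<rho> t y z \<partial>K t y)) + \<alpha> * (\<Sum>y\<in>X. marginal t y * (\<integral>z. W z \<partial>K t y)) - v t"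
      unfolding v_def sum_distrib_left sum.distrib[symmetric] sum_subtractf[symmetric]
      by (intro sum.cong) (auto simp: algebra_simps)
    show ?thesis
      unfolding E v residual by (simp add: right_diff_distrib distrib_left)
  qed
  moreover have "v 0 = W x"
    using finite_X x by (simp add: v_def marginal_0 if_distrib[of "\<lambda>m. m * _"] cong: if_cong)
  ultimately show ?thesis
    by (simp add: u_def)
qed

text \<open>Sub- and supersolution bounds, read off termwise from
  \<open>discounted_reward_sums\<close>. Only the upper bound carries a slack \<open>\<eta>\<close>:
  there the kernels will be near-minimisers, as the infimum over the ambiguity set is not known to
  be attained.\<close>

lemma discounted_reward_bounds:
  fixes \<rho> :: "nat \<Rightarrow> 'a \<Rightarrow> 'a \<Rightarrow> real"
  assumes \<alpha>: "0 \<le> \<alpha>" "\<alpha> < 1"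
    and B: "\<And>t y z. y \<in> X \<Longrightarrow> z \<in> X \<Longrightarrow> \<bar>\<rho> t y z\<bar> \<le> B"
  shows discounted_reward_ge:
      "(\<And>t y. y \<in> X \<Longrightarrow> W y \<le> (\<integral>z. \<rho> t y z + \<alpha> * W z \<partial>K t y)) \<Longrightarrow>
        W x \<le> expectation (\<lambda>\<omega>. \<Sum>t. \<alpha> ^ t * \<rho> t (\<omega> t) (\<omega> (Suc t)))"
    and discounted_reward_le:
      "(\<And>t y. y \<in> X \<Longrightarrow> (\<integral>z. \<rho> t y z + \<alpha> * W z \<partial>K t y) \<le> W y + \<eta>) \<Longrightarrow>
        expectation (\<lambda>\<omega>. \<Sum>t. \<alpha> ^ t * \<rho> t (\<omega> t) (\<omega> (Suc t))) \<le> W x + \<eta> / (1 - \<alpha>)"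
proof -
  let ?E = "expectation (\<lambda>\<omega>. \<Sum>t. \<alpha> ^ t * \<rho> t (\<omega> t) (\<omega> (Suc t)))"
  let ?d = "\<lambda>t y. (\<integral>z. \<rho> t y z + \<alpha> * W z \<partial>K t y) - W y"
  have sums: "(\<lambda>t. \<alpha> ^ t * (\<Sum>y\<in>X. marginal t y * ?d t y)) sums (?E - W x)"
    using assms by (rule discounted_reward_sums)
  show "W x \<le> ?E" if "\<And>t y. y \<in> X \<Longrightarrow> W y \<le> (\<integral>z. \<rho> t y z + \<alpha> * W z \<partial>K t y)"
  proof -
    have "0 \<le> ?E - W x"
      using that \<alpha> marginal_nonneg by (intro sums_le[OF _ sums_zero sums] mult_nonneg_nonneg sum_nonneg) auto
    then show ?thesis by simp
  qed
  show "?E \<le> W x + \<eta> / (1 - \<alpha>)" if "\<And>t y. y \<in> X \<Longrightarrow> (\<integral>z. \<rho> t y z + \<alpha> * W z \<partial>K t y) \<le> W y + \<eta>"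
  proof -
    have "\<alpha> ^ t * (\<Sum>y\<in>X. marginal t y * ?d t y) \<le> \<alpha> ^ t * \<eta>" for t
    proof -
      have "(\<Sum>y\<in>X. marginal t y * ?d t y) \<le> (\<Sum>y\<in>X. marginal t y * \<eta>)"
        using that marginal_nonneg by (intro sum_mono mult_left_mono) (auto simp: algebra_simps)
      also have "\<dots> = \<eta>"
        by (simp add: sum_marginal flip: sum_distrib_right)
      finally show ?thesis
        using \<alpha> by (intro mult_left_mono) auto
    qed
    moreover have "(\<lambda>t. \<alpha> ^ t * \<eta>) sums (1 / (1 - \<alpha>) * \<eta>)"
      using \<alpha> by (intro sums_mult2 geometric_sums) auto
    ultimately have "?E - W x \<le> 1 / (1 - \<alpha>) * \<eta>"
      by (intro sums_le[OF _ sums])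
    then show ?thesis by simp
  qed
qed

end

text \<open>Banach iteration from 0. The one-sided hypothesis combines monotonicity and discounting,
  and used in both directions it gives a contraction for the maximum over \<open>X\<close>. That
  maximum ignores values off \<open>X\<close>, so limits are taken pointwise on \<open>X\<close>;
  finiteness makes this convergence uniform there.\<close>

lemma ex_fixed_point_finite:
  fixes T :: "('a \<Rightarrow> real) \<Rightarrow> 'a \<Rightarrow> real"
  assumes fin: "finite X" and \<alpha>: "0 \<le> \<alpha>" "\<alpha> < 1"
    and T: "\<And>f g c x. (\<And>y. y \<in> X \<Longrightarrow> f y \<le> g y + c) \<Longrightarrow> x \<in> X \<Longrightarrow> T f x \<le> T g x + \<alpha> * c"
  shows "\<exists>W. \<forall>x\<in>X. T W x = W x"
proof -
  have T': "\<bar>T f x - T g x\<bar> \<le> \<alpha> * c" if "\<And>y. y \<in> X \<Longrightarrow> \<bar>f y - g y\<bar> \<le> c" "x \<in> X" for f g c x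
  proof -
    have fg: "f y \<le> g y + c" "g y \<le> f y + c" if "y \<in> X" for y
      using \<open>\<And>y. y \<in> X \<Longrightarrow> \<bar>f y - g y\<bar> \<le> c\<close>[OF that] by linarith+
    have "T f x \<le> T g x + \<alpha> * c" "T g x \<le> T f x + \<alpha> * c"
      using fg \<open>x \<in> X\<close> by (auto intro: T)
    then show ?thesis by linarith
  qed
  define w where "w k = (T ^^ k) (\<lambda>_. 0)" for k
  have w_0: "w 0 x = 0" for x
    by (simp add: w_def)
  have w_Suc: "w (Suc k) = T (w k)" for k
    by (simp add: w_def)
  obtain M where M: "\<forall>x\<in>X. \<bar>w 1 x - w 0 x\<bar> \<le> M"
    using finite_bound[OF fin, of "\<lambda>x. w 1 x - w 0 x"] by auto
  have step: "\<bar>w (Suc k) x - w k x\<bar> \<le> \<alpha> ^ k * M" if "x \<in> X" for k x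
    using that
  proof (induction k arbitrary: x)
    case 0
    then show ?case using M by simp
  next
    case (Suc k)
    show ?case
      using T'[of "w (Suc k)" "w k", OF Suc.IH Suc.prems] by (simp add: w_Suc mult.assoc)
  qed
  have conv: "convergent (\<lambda>k. w k x)" if "x \<in> X" for x
  proof -
    have "summable (\<lambda>k. \<alpha> ^ k * M)"
      using \<alpha> by (intro summable_mult2 summable_geometric) auto
    then have "summable (\<lambda>k. w (Suc k) x - w k x)"
      by (rule summable_comparison_test') (use step that in auto)
    then have "convergent (\<lambda>n. \<Sum>k<n. w (Suc k) x - w k x)"
      by (simp add: summable_iff_convergent)
    then show ?thesis
      using w_0 by (simp add: sum_lessThan_telescope[of "\<lambda>k. w k x"])
  qed
  define W where "W x = lim (\<lambda>k. w k x)" for x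
  have W: "(\<lambda>k. w k x) \<longlonglongrightarrow> W x" if "x \<in> X" for x
    using conv[OF that] by (simp add: W_def convergent_LIMSEQ_iff)
  have "(\<lambda>k. w (Suc k) x) \<longlonglongrightarrow> T W x" if "x \<in> X" for x
  proof (rule tendstoI)
    fix e :: real assume "0 < e"
    then have "\<forall>\<^sub>F k in sequentially. \<forall>y\<in>X. dist (w k y) (W y) < e"
      using fin W by (intro eventually_ball_finite) (auto dest: tendstoD)
    then show "\<forall>\<^sub>F k in sequentially. dist (w (Suc k) x) (T W x) < e"
    proof eventually_elim
      case (elim k)
      have "\<bar>T (w k) x - T W x\<bar> \<le> \<alpha> * e"
        using elim that by (intro T') (auto simp: dist_real_def less_imp_le)
      also have "\<dots> < e"
        using \<alpha> \<open>0 < e\<close> by simp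
      finally show ?case
        by (simp add: w_Suc dist_real_def)
    qed
  qed
  then show ?thesis
    using LIMSEQ_unique[OF _ LIMSEQ_Suc[OF W]] by blast
qed

section \<open>The robust Bellman operator and its fixed point\<close>

locale finite_robust_mdp =
  fixes X :: "'a set" and A :: "'b set" and r :: "'a \<Rightarrow> 'b \<Rightarrow> 'a \<Rightarrow> real" and \<alpha> :: real
    and R :: "'a \<Rightarrow> 'b \<Rightarrow> 'a measure set"
  assumes finite_X: "finite X" and finite_A: "finite A" and nonempty_A: "A \<noteq> {}"
    and \<alpha>: "0 \<le> \<alpha>" "\<alpha> < 1"
    and R_M1: "\<And>x a. x \<in> X \<Longrightarrow> a \<in> A \<Longrightarrow> R x a \<subseteq> M1 X"
    and R_nonempty: "\<And>x a. x \<in> X \<Longrightarrow> a \<in> A \<Longrightarrow> R x a \<noteq> {}"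
begin

definition q_value :: "('a \<Rightarrow> real) \<Rightarrow> 'a \<Rightarrow> 'b \<Rightarrow> real"
  where "q_value W x a = (INF P\<in>R x a. \<integral>y. r x a y + \<alpha> * W y \<partial>P)"

lemma bdd_below_q_value:
  assumes "x \<in> X" "a \<in> A"
  shows "bdd_below ((\<lambda>P. \<integral>y. r x a y + \<alpha> * W y \<partial>P) ` R x a)"
proof -
  obtain B where B: "\<forall>y\<in>X. \<bar>r x a y + \<alpha> * W y\<bar> \<le> B"
    using finite_bound[OF finite_X, of "\<lambda>y. r x a y + \<alpha> * W y"] by auto
  have "- B \<le> (\<integral>y. r x a y + \<alpha> * W y \<partial>P)" if "P \<in> R x a" for P
  proof -
    have "0 \<le> r x a y + \<alpha> * W y + B" if "y \<in> X" for y
      using B that by (auto simp: abs_le_iff)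
    then show ?thesis
      using M1_integral_le[of X P "\<lambda>_. 0" "\<lambda>y. r x a y + \<alpha> * W y" B] that R_M1[OF assms] finite_X by fastforce
  qed
  then show ?thesis
    by (rule bdd_belowI2)
qed

lemma q_value_le:
  assumes "x \<in> X" "a \<in> A" "P \<in> R x a"
  shows "q_value W x a \<le> (\<integral>y. r x a y + \<alpha> * W y \<partial>P)"
  unfolding q_value_def using assms by (intro cINF_lower bdd_below_q_value)

text \<open>Bridge between the extended-real infima of the final theorem and the real-valued
  operator.\<close>

lemma ereal_q_value:
  assumes "x \<in> X" "a \<in> A"
  shows "(INF P\<in>R x a. ereal (\<integral>y. r x a y + \<alpha> * W y \<partial>P)) = ereal (q_value W x a)"
  unfolding q_value_def using bdd_below_q_value[OF assms, of W] R_nonempty[OF assms]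
  by (subst ereal_Inf') (auto simp: image_image)

lemma q_value_mono:
  assumes "\<And>y. y \<in> X \<Longrightarrow> W y \<le> W' y + c" "x \<in> X" "a \<in> A"
  shows "q_value W x a \<le> q_value W' x a + \<alpha> * c"
proof -
  have "q_value W x a - \<alpha> * c \<le> (\<integral>y. r x a y + \<alpha> * W' y \<partial>P)" if "P \<in> R x a" for P
  proof -
    have "r x a y + \<alpha> * W y \<le> r x a y + \<alpha> * W' y + \<alpha> * c" if "y \<in> X" for y
      using mult_left_mono[OF assms(1)[OF that] \<alpha>(1)] by (simp add: algebra_simps)
    then show ?thesis
      using q_value_le[OF assms(2,3) that, of W]
        M1_integral_le[of X P "\<lambda>y. r x a y + \<alpha> * W y" "\<lambda>y. r x a y + \<alpha> * W' y" "\<alpha> * c"]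
        that R_M1[OF assms(2,3)] finite_X by fastforce
  qed
  then have "q_value W x a - \<alpha> * c \<le> q_value W' x a"
    unfolding q_value_def[of W'] using R_nonempty[OF assms(2,3)] by (intro cINF_greatest)
  then show ?thesis by simp
qed

definition bellman :: "('a \<Rightarrow> real) \<Rightarrow> 'a \<Rightarrow> real"
  where "bellman W x = Max (q_value W x ` A)"

lemma q_value_le_bellman: "a \<in> A \<Longrightarrow> q_value W x a \<le> bellman W x"
  using finite_A by (auto simp: bellman_def)

lemma ex_bellman: "\<exists>a\<in>A. q_value W x a = bellman W x"
proof -
  have "bellman W x \<in> q_value W x ` A"
    unfolding bellman_def using finite_A nonempty_A by (intro Max_in) auto
  then show ?thesis by auto
qed

lemma ex_bellman_fixed_point: "\<exists>W. \<forall>x\<in>X. bellman W x = W x"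
proof (rule ex_fixed_point_finite[OF finite_X \<alpha>])
  fix f g :: "'a \<Rightarrow> real" and c x
  assume "\<And>y. y \<in> X \<Longrightarrow> f y \<le> g y + c" "x \<in> X"
  then show "bellman f x \<le> bellman g x + \<alpha> * c"
    using ex_bellman[of f x] q_value_mono[of f g c x] q_value_le_bellman[of _ g x] by fastforce
qed

lemma bounded_reward: "\<exists>B. \<forall>x\<in>X. \<forall>a\<in>A. \<forall>y\<in>X. \<bar>r x a y\<bar> \<le> B"
  using finite_bound[of "X \<times> A \<times> X" "\<lambda>(x, a, y). r x a y"] finite_X finite_A by fastforce

text \<open>Admissible kernels are chosen separately for every time and state, so both players can
  be treated stepwise. Against the stationary greedy policy every kernel has nonnegative residuals,
  which gives the lower bound; against any policy a kernel with residuals at most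
  \<open>\<eta>\<close> gives the upper bound.\<close>

theorem robust_value_eq_fixed_point:
  assumes W: "\<And>x. x \<in> X \<Longrightarrow> bellman W x = W x" and x: "x \<in> X"
  shows "robust_value \<alpha> r X A R x = ereal (W x)"
proof (rule antisym)
  define F where "F a = (INF P\<in>path_law X x ` admissible_kernels X R a.
    ereal (\<integral>\<omega>. (\<Sum>t. \<alpha> ^ t * r (\<omega> t) (a t (\<omega> t)) (\<omega> (Suc t))) \<partial>P))" for a
  have value_eq: "robust_value \<alpha> r X A R x = (SUP a\<in>policies X A. F a)"
    by (simp add: robust_value_def F_def)
  obtain B where B: "\<And>x a y. x \<in> X \<Longrightarrow> a \<in> A \<Longrightarrow> y \<in> X \<Longrightarrow> \<bar>r x a y\<bar> \<le> B"
    using bounded_reward by blast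
  have pol: "a t y \<in> A" if "a \<in> policies X A" "y \<in> X" for a t y
    using that by (auto simp: policies_def)
  have path: "finite_markov_path X x K"
    if "a \<in> policies X A" "K \<in> admissible_kernels X R a" for a K
  proof
    show "K t y \<in> M1 X" if "y \<in> X" for t y
      using \<open>K \<in> _\<close> R_M1[OF that pol[OF \<open>a \<in> _\<close> that]] that by (auto simp: admissible_kernels_def)
  qed (use finite_X x in auto)
  show "ereal (W x) \<le> robust_value \<alpha> r X A R x"
  proof -
    obtain a0 where a0: "\<And>y. a0 y \<in> A" "\<And>y. q_value W y (a0 y) = bellman W y"
      using ex_bellman[of W] by metis
    define a where "a = (\<lambda>_::nat. a0)"
    have a: "a \<in> policies X A"
      using a0 by (auto simp: a_def policies_def)
    have "W x \<le> (\<integral>\<omega>. (\<Sum>t. \<alpha> ^ t * r (\<omega> t) (a t (\<omega> t)) (\<omega> (Suc t))) \<partial>path_law X x K)"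
      if adm: "K \<in> admissible_kernels X R a" for K
    proof -
      interpret finite_markov_path X x K
        using path[OF a adm] .
      show ?thesis
      proof (rule discounted_reward_ge[OF \<alpha>, of "\<lambda>t y z. r y (a t y) z" B])
        fix t y assume y: "y \<in> X"
        have "W y = q_value W y (a t y)"
          using W[OF y] a0 by (simp add: a_def)
        also have "\<dots> \<le> (\<integral>z. r y (a t y) z + \<alpha> * W z \<partial>K t y)"
          using adm y by (intro q_value_le pol[OF a]) (auto simp: admissible_kernels_def)
        finally show "W y \<le> (\<integral>z. r y (a t y) z + \<alpha> * W z \<partial>K t y)" .
      qed (use B pol[OF a] in auto)
    qed
    then have "ereal (W x) \<le> F a"
      unfolding F_def by (intro INF_greatest) auto
    also have "\<dots> \<le> robust_value \<alpha> r X A R x"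
      unfolding value_eq by (rule SUP_upper[OF a])
    finally show ?thesis .
  qed
  show "robust_value \<alpha> r X A R x \<le> ereal (W x)"
    unfolding value_eq
  proof (rule SUP_least, rule ereal_le_epsilon2)
    fix a and e :: real assume a: "a \<in> policies X A" and "0 < e"
    \<comment> \<open>Chosen so that the discounted total \<open>\<eta> / (1 - \<alpha>)\<close> of
      the one-step slacks is \<open>e\<close>.\<close>
    define \<eta> where "\<eta> = e * (1 - \<alpha>)"
    have "0 < \<eta>"
      using \<open>0 < e\<close> \<alpha> by (simp add: \<eta>_def)
    have "\<exists>P\<in>R y (a t y). (\<integral>z. r y (a t y) z + \<alpha> * W z \<partial>P) < W y + \<eta>" if y: "y \<in> X" for t y
    proof -
      have "q_value W y (a t y) < W y + \<eta>"
        using q_value_le_bellman[OF pol[OF a y], of W y] W[OF y] \<open>0 < \<eta>\<close> by (smt (verit) order_trans)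
      then show ?thesis
        unfolding q_value_def using R_nonempty[OF y pol[OF a y]] bdd_below_q_value[OF y pol[OF a y]]
        by (subst (asm) cINF_less_iff) auto
    qed
    then have "\<forall>t. \<forall>y. \<exists>P. y \<in> X \<longrightarrow> P \<in> R y (a t y) \<and> (\<integral>z. r y (a t y) z + \<alpha> * W z \<partial>P) < W y + \<eta>"
      by blast
    then obtain K where kernels: "\<And>t y. y \<in> X \<Longrightarrow> K t y \<in> R y (a t y)"
        "\<And>t y. y \<in> X \<Longrightarrow> (\<integral>z. r y (a t y) z + \<alpha> * W z \<partial>K t y) < W y + \<eta>"
      unfolding choice_iff by blast
    have adm: "K \<in> admissible_kernels X R a"
      using kernels(1) by (auto simp: admissible_kernels_def)
    interpret finite_markov_path X x K
      using path[OF a adm] .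
    have "expectation (\<lambda>\<omega>. \<Sum>t. \<alpha> ^ t * r (\<omega> t) (a t (\<omega> t)) (\<omega> (Suc t))) \<le> W x + \<eta> / (1 - \<alpha>)"
      using B pol[OF a] kernels(2)
      by (intro discounted_reward_le[OF \<alpha>, of "\<lambda>t y z. r y (a t y) z" B]) (auto simp: less_imp_le)
    then have "ereal (expectation (\<lambda>\<omega>. \<Sum>t. \<alpha> ^ t * r (\<omega> t) (a t (\<omega> t)) (\<omega> (Suc t)))) \<le> ereal (W x) + ereal e"
      using \<alpha> by (simp add: \<eta>_def)
    then show "F a \<le> ereal (W x) + ereal e"
      unfolding F_def using adm by (intro INF_lower2[of law]) auto
  qed
qed

lemma robust_value_bellman:
  shows "\<exists>W. \<forall>x\<in>X. robust_value \<alpha> r X A R x = ereal (W x) \<and> bellman W x = W x"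
  using ex_bellman_fixed_point robust_value_eq_fixed_point by metis

end

section \<open>Approximation by grid measures\<close>

lemma grid_measure_near:
  assumes fin: "finite X" and P: "P \<in> M1 X" and D: "0 \<le> D" "\<And>x y. x \<in> X \<Longrightarrow> y \<in> X \<Longrightarrow> norm (x - y) \<le> D"
    and "1 \<le> p" "1 \<le> n"
  shows "\<exists>P'\<in>grid_measures X n. wasserstein X p P' P \<le> D * real (card X) powr (1 / real p) / real n powr (1 / real p)"
proof -
  let ?p = "\<lambda>x. measure P {x}"
  let ?e = "D * real (card X) powr (1 / real p) / real n powr (1 / real p)"
  have sum_p: "sum ?p X = 1"
    by (rule sum_measure_M1[OF fin P])
  then have "card X > 0"
    using fin by (auto simp: card_gt_0_iff)
  obtain P' where P': "P' \<in> grid_measures X n" "excess X ?p (\<lambda>x. measure P' {x}) \<le> real (card X) / (2 * real n)"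
    using ex_grid_measure[OF fin _ sum_p \<open>1 \<le> n\<close>] by auto
  then have M1: "P' \<in> M1 X"
    by (simp add: grid_measures_def)
  \<comment> \<open>Start from the free coupling of \<open>P\<close> with itself and move only its
    first marginal to the grid.\<close>
  have "(\<lambda>x y. if x = y then ?p x else 0) \<in> transport_plans X ?p ?p"
    and cost_0: "transport_cost X p (\<lambda>x y. if x = y then ?p x else 0) = 0"
    using fin \<open>1 \<le> p\<close> by (auto intro: diagonal_plan)
  from moved_plan[OF fin this(1) _ sum_p _ sum_measure_M1[OF fin M1] D(2), of p]
  obtain c where c: "c \<in> transport_plans X (\<lambda>x. measure P' {x}) ?p"
      "transport_cost X p c \<le> D ^ p * excess X ?p (\<lambda>x. measure P' {x})"
    unfolding cost_0 by auto
  have "optimal_cost X p (\<lambda>x. measure P' {x}) ?p \<le> D ^ p * excess X ?p (\<lambda>x. measure P' {x})"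
    using optimal_cost_le[OF c(1), of p] c(2) by simp
  also have "\<dots> \<le> D ^ p * (real (card X) / (2 * real n))"
    using P'(2) D(1) by (intro mult_left_mono) auto
  also have "\<dots> \<le> D ^ p * (real (card X) / real n)"
    using D(1) \<open>1 \<le> n\<close> by (intro mult_left_mono frac_le) auto
  also have "\<dots> = ?e ^ p"
    using \<open>card X > 0\<close> \<open>1 \<le> n\<close> \<open>1 \<le> p\<close> by (simp add: power_divide power_mult_distrib powr_power)
  finally have "wasserstein X p P' P \<le> ?e"
    using D(1) \<open>1 \<le> p\<close> by (subst wasserstein_le_iff[OF fin M1 P]) auto
  with P'(1) show ?thesis by auto
qed

lemma optimal_cost_1_le:
  assumes fin: "finite X" and D: "\<And>x y. x \<in> X \<Longrightarrow> y \<in> X \<Longrightarrow> norm (x - y) \<le> D"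
    and "\<And>x. x \<in> X \<Longrightarrow> 0 \<le> p x" "\<And>x. x \<in> X \<Longrightarrow> 0 \<le> s x" "sum p X = 1" "sum s X = 1"
  shows "optimal_cost X 1 p s \<le> D"
proof -
  obtain c where c: "c \<in> transport_plans X p s"
    using transport_plans_nonempty[of X p s] assms by auto
  have "transport_cost X 1 c \<le> (\<Sum>x\<in>X. \<Sum>y\<in>X. c x y * D)"
    unfolding transport_cost_def using c D by (intro sum_mono mult_left_mono) (auto simp: transport_plans_def)
  also have "\<dots> = D"
    using c assms(5) by (simp add: transport_plans_def flip: sum_distrib_right)
  finally show ?thesis
    using optimal_cost_le[OF c, of 1] by simp
qed

text \<open>Mixing \<open>P\<close> with the centre \<open>P0\<close> of the ball makes room for the subsequent rounding to the grid.\<close>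

lemma ex_grid_measure_in_ball:
  assumes fin: "finite X" and P0: "P0 \<in> M1 X" and P: "P \<in> wasserstein_ball X q \<epsilon> P0"
    and D: "0 \<le> D" "\<And>x y. x \<in> X \<Longrightarrow> y \<in> X \<Longrightarrow> norm (x - y) \<le> D"
    and "0 < \<epsilon>" "1 \<le> q" "1 \<le> n"
    and l: "l = D ^ q * real (card X) / (2 * real n * \<epsilon> ^ q)" "l \<le> 1"
  shows "\<exists>P'\<in>wasserstein_ball X q \<epsilon> P0 \<inter> grid_measures X n. \<forall>f L. 0 \<le> L \<longrightarrow>
    (\<forall>x\<in>X. \<forall>y\<in>X. \<bar>f x - f y\<bar> \<le> L * norm (x - y)) \<longrightarrow>
    (\<integral>x. f x \<partial>P') \<le> (\<integral>x. f x \<partial>P) +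
      L * (l * optimal_cost X 1 (\<lambda>x. measure P {x}) (\<lambda>x. measure P0 {x}) + D * (real (card X) / (2 * real n)))"
proof -
  define p where "p x = measure P {x}" for x
  define s where "s x = measure P0 {x}" for x
  define m where "m x = (1 - l) * p x + l * s x" for x
  let ?\<tau> = "real (card X) / (2 * real n)"
  have PM: "P \<in> M1 X"
    using P by (simp add: wasserstein_ball_def)
  have p: "0 \<le> p x" "sum p X = 1" and s: "0 \<le> s x" "sum s X = 1" for x
    using sum_measure_M1[OF fin PM] sum_measure_M1[OF fin P0] by (auto simp: p_def s_def)
  have l0: "0 \<le> l"
    using D \<open>0 < \<epsilon>\<close> by (simp add: l)
  have m: "0 \<le> m x" "sum m X = 1" for x
    using p s l0 l(2) by (auto simp: m_def sum.distrib simp flip: sum_distrib_left)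
  obtain P' where P': "P' \<in> grid_measures X n" and ex: "excess X m (\<lambda>x. measure P' {x}) \<le> ?\<tau>"
    using ex_grid_measure[OF fin m \<open>1 \<le> n\<close>] by auto
  define p' where "p' x = measure P' {x}" for x
  have P'M: "P' \<in> M1 X"
    using P' by (simp add: grid_measures_def)
  have p': "0 \<le> p' x" "sum p' X = 1" for x
    using sum_measure_M1[OF fin P'M] by (auto simp: p'_def)
  have ex: "excess X m p' \<le> ?\<tau>"
    using ex by (simp add: p'_def[abs_def])
  have plans: "transport_plans X p s \<noteq> {}"
    using p s by (intro transport_plans_nonempty)
  have "optimal_cost X q p' s \<le> (1 - l) * optimal_cost X q p s + D ^ q * ?\<tau>"
  proof (rule le_optimal_cost[OF plans])
    fix c assume "c \<in> transport_plans X p s"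
    then obtain c1 where c1: "c1 \<in> transport_plans X m s" "transport_cost X q c1 = (1 - l) * transport_cost X q c"
      using mixed_plan[of X s q l c p] fin s(1) \<open>1 \<le> q\<close> l0 l(2) by (auto simp: m_def[abs_def])
    obtain c2 where c2: "c2 \<in> transport_plans X p' s" "transport_cost X q c2 \<le> transport_cost X q c1 + D ^ q * excess X m p'"
      using moved_plan[OF fin c1(1) m p' D(2), of q] by auto
    have "D ^ q * excess X m p' \<le> D ^ q * ?\<tau>"
      using ex D(1) by (intro mult_left_mono) auto
    then show "optimal_cost X q p' s \<le> (1 - l) * transport_cost X q c + D ^ q * ?\<tau>"
      using optimal_cost_le[OF c2(1), of q] c2(2) c1(2) by linarith
  qed (use l in auto)
  also have "\<dots> \<le> (1 - l) * \<epsilon> ^ q + D ^ q * ?\<tau>"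
    using P wasserstein_le_iff[OF fin PM P0, of \<epsilon> q] \<open>0 < \<epsilon>\<close> \<open>1 \<le> q\<close> l(2)
    by (intro add_right_mono mult_left_mono) (auto simp: p_def[abs_def] s_def[abs_def] wasserstein_ball_def)
  \<comment> \<open>This equation determines \<open>l\<close>: the room gained by mixing is exactly
    used up by rounding.\<close>
  also have "D ^ q * ?\<tau> = l * \<epsilon> ^ q"
    using \<open>0 < \<epsilon>\<close> by (simp add: l)
  finally have "optimal_cost X q p' s \<le> \<epsilon> ^ q"
    by (simp add: left_diff_distrib)
  then have ball: "P' \<in> wasserstein_ball X q \<epsilon> P0"
    using wasserstein_le_iff[OF fin P'M P0, of \<epsilon> q] \<open>0 < \<epsilon>\<close> \<open>1 \<le> q\<close> P'M
    by (simp add: p'_def[abs_def] s_def[abs_def] wasserstein_ball_def)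
  have diff: "(\<integral>x. f x \<partial>P') \<le> (\<integral>x. f x \<partial>P) + L * (l * optimal_cost X 1 p s + D * ?\<tau>)"
    if "0 \<le> L" and L: "\<And>x y. x \<in> X \<Longrightarrow> y \<in> X \<Longrightarrow> \<bar>f x - f y\<bar> \<le> L * norm (x - y)" for f L
  proof -
    \<comment> \<open>The difference between \<open>p'\<close> and \<open>p\<close> is split at the
      mixture \<open>m\<close>: rounding leads from \<open>m\<close> to \<open>p'\<close>, while
      \<open>m\<close> differs from \<open>p\<close> by \<open>l * (s - p)\<close>.\<close>
    have "(\<lambda>x y. if x = y then m x else 0) \<in> transport_plans X m m"
      and cost_0: "transport_cost X 1 (\<lambda>x y. if x = y then m x else 0) = 0"
      using fin m by (auto intro: diagonal_plan)
    from moved_plan[OF fin this(1) m p' D(2), of 1]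
    obtain c where c: "c \<in> transport_plans X p' m" "transport_cost X 1 c \<le> D * excess X m p'"
      unfolding cost_0 by auto
    have "(\<Sum>x\<in>X. p' x * f x) - (\<Sum>x\<in>X. m x * f x) \<le> L * transport_cost X 1 c"
      using c(1) L by (rule transport_difference_le)
    also have "\<dots> \<le> L * (D * ?\<tau>)"
      using c(2) ex D(1) \<open>0 \<le> L\<close> by (meson mult_left_mono order_trans)
    finally have rounding: "(\<Sum>x\<in>X. p' x * f x) - (\<Sum>x\<in>X. m x * f x) \<le> L * (D * ?\<tau>)" .
    have "(\<Sum>x\<in>X. s x * f x) - (\<Sum>x\<in>X. p x * f x) \<le> L * optimal_cost X 1 p s + 0"
    proof (rule le_optimal_cost[OF plans \<open>0 \<le> L\<close>])
      fix c assume "c \<in> transport_plans X p s"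
      \<comment> \<open>The plan runs from \<open>p\<close> to \<open>s\<close>, but
        \<open>s\<close> minus \<open>p\<close> has to be bounded; passing to \<open>- f\<close>
        reverses the sign.\<close>
      then have "(\<Sum>x\<in>X. p x * - f x) - (\<Sum>x\<in>X. s x * - f x) \<le> L * transport_cost X 1 c"
        by (rule transport_difference_le) (use L in \<open>simp add: abs_minus_commute\<close>)
      then show "(\<Sum>x\<in>X. s x * f x) - (\<Sum>x\<in>X. p x * f x) \<le> L * transport_cost X 1 c + 0"
        by (simp add: sum_negf)
    qed
    then have "l * ((\<Sum>x\<in>X. s x * f x) - (\<Sum>x\<in>X. p x * f x)) \<le> l * (L * optimal_cost X 1 p s)"
      using l0 by (intro mult_left_mono) auto
    moreover have "(\<Sum>x\<in>X. m x * f x) = (\<Sum>x\<in>X. p x * f x) + l * ((\<Sum>x\<in>X. s x * f x) - (\<Sum>x\<in>X. p x * f x))"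
      unfolding sum_subtractf[symmetric] sum_distrib_left sum.distrib[symmetric] m_def
      by (intro sum.cong) (auto simp: algebra_simps)
    ultimately have "(\<Sum>x\<in>X. p' x * f x) \<le> (\<Sum>x\<in>X. p x * f x) + L * (l * optimal_cost X 1 p s + D * ?\<tau>)"
      using rounding by (simp add: distrib_left mult.left_commute)
    then show ?thesis
      by (simp add: integral_M1[OF fin PM] integral_M1[OF fin P'M] p_def p'_def)
  qed
  show ?thesis
    using ball P' diff unfolding p_def[symmetric] s_def[symmetric] by (intro bexI[of _ P']) auto
qed

text \<open>For \<open>q = 1\<close> mixing and rounding each cost half of the available \<open>D * card X / n\<close>. For \<open>q \<ge> 2\<close>
  both errors are \<open>O(1 / n)\<close>, hence eventually below \<open>\<epsilon> / n powr (1 / q)\<close>.\<close>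

lemma eventually_grid_approximation:
  fixes X :: "'a::real_normed_vector set"
  assumes fin: "finite X" and "0 \<le> D" "\<forall>x\<in>X. \<forall>y\<in>X. norm (x - y) \<le> D"
    and "0 < \<epsilon>" "1 \<le> q"
  shows "\<forall>\<^sub>F n in sequentially. \<forall>P0\<in>M1 X. \<forall>P\<in>wasserstein_ball X q \<epsilon> P0.
    \<exists>P'\<in>wasserstein_ball X q \<epsilon> P0 \<inter> grid_measures X n. \<forall>f L. 0 \<le> L \<longrightarrow>
      (\<forall>x\<in>X. \<forall>y\<in>X. \<bar>f x - f y\<bar> \<le> L * norm (x - y)) \<longrightarrow>
      (\<integral>x. f x \<partial>P') \<le> (\<integral>x. f x \<partial>P) +
        L * ((\<epsilon> + D * real (card X) powr (1 / real q)) / real n powr (1 / real q))"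
proof -
  have D: "0 \<le> D" "\<And>x y. x \<in> X \<Longrightarrow> y \<in> X \<Longrightarrow> norm (x - y) \<le> D"
    using assms by auto
  define l where "l n = D ^ q * real (card X) / (2 * real n * \<epsilon> ^ q)" for n
  let ?\<tau> = "\<lambda>n. real (card X) / (2 * real n)"
  let ?b = "\<lambda>n. (\<epsilon> + D * real (card X) powr (1 / real q)) / real n powr (1 / real q)"
  have "(\<lambda>n. D ^ q * real (card X) / (2 * \<epsilon> ^ q) / real n) \<longlonglongrightarrow> 0"
    by (rule lim_const_over_n)
  then have "\<forall>\<^sub>F n in sequentially. l n < 1"
    by (intro order_tendstoD(2)[of l 0]) (auto simp: l_def[abs_def] field_simps)
  moreover have "\<forall>\<^sub>F n in sequentially. 2 \<le> q \<longrightarrow> l n * D + D * ?\<tau> n \<le> ?b n"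
  proof (cases "2 \<le> q")
    case True
    \<comment> \<open>\<open>B / n\<close> is the sum of both errors with W_1(P, P0) replaced by the
      diameter bound \<open>D\<close>. As \<open>1 / q - 1 < 0\<close>, it is eventually below the
      \<open>\<epsilon>\<close> part of the target alone.\<close>
    define B where "B = D ^ q * real (card X) * D / (2 * \<epsilon> ^ q) + D * real (card X) / 2"
    have "((\<lambda>n. B * real n powr (1 / real q - 1)) \<longlongrightarrow> B * 0) sequentially"
      using True by (intro tendsto_mult tendsto_const tendsto_neg_powr filterlim_real_sequentially) auto
    then have "\<forall>\<^sub>F n in sequentially. B * real n powr (1 / real q - 1) < \<epsilon>"
      using \<open>0 < \<epsilon>\<close> by (intro order_tendstoD(2)) auto
    then show ?thesis
      using eventually_gt_at_top[of 0]
    proof eventually_elim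
      case (elim n)
      have "l n * D + D * ?\<tau> n = B / real n"
        using \<open>0 < \<epsilon>\<close> elim by (simp add: l_def B_def add_divide_distrib)
      also have "\<dots> = B * real n powr (1 / real q - 1) / real n powr (1 / real q)"
        using elim by (simp add: powr_diff)
      also have "\<dots> \<le> ?b n"
        using elim D(1) by (intro divide_right_mono) (auto intro: order_trans[of _ \<epsilon>])
      finally show ?case by simp
    qed
  qed simp
  ultimately show ?thesis
    using eventually_ge_at_top[of 1]
  proof eventually_elim
    case (elim n)
    show ?case
    proof (intro ballI)
      fix P0 P assume P0: "P0 \<in> M1 X" and P: "P \<in> wasserstein_ball X q \<epsilon> P0"
      let ?w = "optimal_cost X 1 (\<lambda>x. measure P {x}) (\<lambda>x. measure P0 {x})"
      have PM: "P \<in> M1 X"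
        using P by (simp add: wasserstein_ball_def)
      have bound: "l n * ?w + D * ?\<tau> n \<le> ?b n"
      proof (cases "q = 1")
        case True
        \<comment> \<open>For \<open>q = 1\<close> the cost in question is the one that defines the
          ball, and its bound cancels the \<open>\<epsilon>\<close> in the denominator of
          \<open>l n\<close>.\<close>
        then have "?w \<le> \<epsilon>"
          using wasserstein_le_iff[OF fin PM P0, of \<epsilon> 1] P \<open>0 < \<epsilon>\<close> by (simp add: wasserstein_ball_def)
        then have "l n * ?w + D * ?\<tau> n \<le> l n * \<epsilon> + D * ?\<tau> n"
          using D(1) \<open>0 < \<epsilon>\<close> by (intro add_right_mono mult_left_mono) (auto simp: l_def)
        also have "\<dots> = D * real (card X) / real n"
          using True \<open>0 < \<epsilon>\<close> elim by (simp add: l_def field_simps)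
        also have "\<dots> \<le> ?b n"
          using True \<open>0 < \<epsilon>\<close> elim by (simp add: divide_right_mono)
        finally show ?thesis .
      next
        case False
        \<comment> \<open>For larger \<open>q\<close> the crude bound suffices, because
          \<open>l n\<close> is already of order 1/n.\<close>
        have "?w \<le> D"
          using fin D(2) sum_measure_M1[OF fin PM] sum_measure_M1[OF fin P0] by (intro optimal_cost_1_le) auto
        then have "l n * ?w + D * ?\<tau> n \<le> l n * D + D * ?\<tau> n"
          using D(1) \<open>0 < \<epsilon>\<close> by (intro add_right_mono mult_left_mono) (auto simp: l_def)
        with False elim \<open>1 \<le> q\<close> show ?thesis
          by linarith
      qed
      have "(\<exists>P'\<in>wasserstein_ball X q \<epsilon> P0 \<inter> grid_measures X n. \<forall>f L. 0 \<le> L \<longrightarrow>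
          (\<forall>x\<in>X. \<forall>y\<in>X. \<bar>f x - f y\<bar> \<le> L * norm (x - y)) \<longrightarrow>
          (\<integral>x. f x \<partial>P') \<le> (\<integral>x. f x \<partial>P) + L * (l n * ?w + D * ?\<tau> n))"
        using elim fin P0 P D \<open>0 < \<epsilon>\<close> \<open>1 \<le> q\<close> by (intro ex_grid_measure_in_ball) (auto simp: l_def)
      then obtain P' where P': "P' \<in> wasserstein_ball X q \<epsilon> P0 \<inter> grid_measures X n"
        "\<And>f L. 0 \<le> L \<Longrightarrow> \<forall>x\<in>X. \<forall>y\<in>X. \<bar>f x - f y\<bar> \<le> L * norm (x - y) \<Longrightarrow>
          (\<integral>x. f x \<partial>P') \<le> (\<integral>x. f x \<partial>P) + L * (l n * ?w + D * ?\<tau> n)"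
        by blast
      have "(\<integral>x. f x \<partial>P') \<le> (\<integral>x. f x \<partial>P) + L * ?b n"
        if "0 \<le> L" "\<forall>x\<in>X. \<forall>y\<in>X. \<bar>f x - f y\<bar> \<le> L * norm (x - y)" for f L
        using P'(2)[OF that] mult_left_mono[OF bound that(1)] by linarith
      with P'(1) show "\<exists>P'\<in>wasserstein_ball X q \<epsilon> P0 \<inter> grid_measures X n. \<forall>f L. 0 \<le> L \<longrightarrow>
          (\<forall>x\<in>X. \<forall>y\<in>X. \<bar>f x - f y\<bar> \<le> L * norm (x - y)) \<longrightarrow>
          (\<integral>x. f x \<partial>P') \<le> (\<integral>x. f x \<partial>P) + L * ?b n"
        by blast
    qed
  qed
qed

section \<open>The ball, slopes, and the comparison of nested ambiguity sets\<close>

lemma center_in_wasserstein_ball: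
  assumes "finite X" "P0 \<in> M1 X" "0 \<le> \<epsilon>" "1 \<le> q"
  shows "P0 \<in> wasserstein_ball X q \<epsilon> P0"
proof -
  let ?p = "\<lambda>x. measure P0 {x}"
  have "optimal_cost X q ?p ?p \<le> 0"
    using diagonal_plan[of X ?p q] assms optimal_cost_le[of _ X ?p ?p q] by fastforce
  also have "0 \<le> \<epsilon> ^ q"
    using assms by simp
  finally show ?thesis
    using assms by (simp add: wasserstein_ball_def wasserstein_le_iff)
qed

text \<open>The inserted 0 makes the maximum exist and be nonnegative even for a singleton; pairs
  with \<open>x = y\<close> satisfy the Lipschitz bound trivially.\<close>

lemma max_slope_real:
  assumes fin: "finite X" and f: "\<And>x. x \<in> X \<Longrightarrow> f x = ereal (g x)"
  shows "\<exists>L\<ge>0. max_slope X f = ereal L \<and> (\<forall>x\<in>X. \<forall>y\<in>X. \<bar>g x - g y\<bar> \<le> L * norm (x - y))"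
proof -
  let ?I = "{(x, y). x \<in> X \<and> y \<in> X \<and> x \<noteq> y}"
  let ?S = "insert 0 ((\<lambda>(x, y). \<bar>f x - f y\<bar> / ereal (norm (x - y))) ` ?I)"
  have quotient: "\<bar>f x - f y\<bar> / ereal (norm (x - y)) = ereal (\<bar>g x - g y\<bar> / norm (x - y))"
    if "x \<in> X" "y \<in> X" "x \<noteq> y" for x y
    using that by (simp add: f)
  have "finite ?I"
    using fin by (intro finite_subset[of ?I "X \<times> X"]) auto
  then have S: "finite ?S"
    by simp
  have "Max ?S \<in> ?S"
    using S by (intro Max_in) auto
  then obtain L where L: "Max ?S = ereal L"
    using quotient by (auto simp: zero_ereal_def)
  have "0 \<le> Max ?S"
    using S by (intro Max_ge) auto
  then have "0 \<le> L"
    by (simp add: L)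
  moreover have "\<bar>g x - g y\<bar> \<le> L * norm (x - y)" if "x \<in> X" "y \<in> X" for x y
  proof (cases "x = y")
    case False
    then have "ereal (\<bar>g x - g y\<bar> / norm (x - y)) \<le> Max ?S"
      using that S quotient[OF that False] by (intro Max_ge) (auto intro!: image_eqI[of _ _ "(x, y)"])
    then show ?thesis
      using False by (simp add: L divide_le_eq)
  qed simp
  ultimately show ?thesis
    using L unfolding max_slope_def by blast
qed

text \<open>\<open>\<delta>\<close> compares both operators at the single function \<open>W\<close>;
  monotonicity replaces \<open>W'\<close> by \<open>W + g\<close>. At a state where
  \<open>W' - W\<close> is largest this yields
  \<open>g \<le> \<delta> + \<alpha> * g\<close>.\<close>

lemma q_value_fixed_point_le:
  assumes "finite_robust_mdp X A \<alpha> R" "finite_robust_mdp X A \<alpha> R'"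
    and W: "\<And>x. x \<in> X \<Longrightarrow> finite_robust_mdp.bellman A r \<alpha> R W x = W x"
    and W': "\<And>x. x \<in> X \<Longrightarrow> finite_robust_mdp.bellman A r \<alpha> R' W' x = W' x"
    and \<delta>: "\<And>x a. x \<in> X \<Longrightarrow> a \<in> A \<Longrightarrow>
      finite_robust_mdp.q_value r \<alpha> R' W x a \<le> finite_robust_mdp.q_value r \<alpha> R W x a + \<delta>"
    and xa: "x \<in> X" "a \<in> A"
  shows "finite_robust_mdp.q_value r \<alpha> R' W' x a \<le> finite_robust_mdp.q_value r \<alpha> R W x a + \<delta> / (1 - \<alpha>)"
proof -
  interpret M: finite_robust_mdp X A r \<alpha> R by fact
  interpret N: finite_robust_mdp X A r \<alpha> R' by fact
  \<comment> \<open>The signed maximum, possibly negative: \<open>q_value_mono\<close> allows shifts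
    of either sign, so the estimate stays one-sided.\<close>
  define g where "g = Max ((\<lambda>x. W' x - W x) ` X)"
  have g: "W' y \<le> W y + g" if "y \<in> X" for y
  proof -
    have "W' y - W y \<le> g"
      unfolding g_def using M.finite_X that by (intro Max_ge) auto
    then show ?thesis by simp
  qed
  have step: "N.q_value W' y b \<le> M.q_value W y b + (\<delta> + \<alpha> * g)" if "y \<in> X" "b \<in> A" for y b
    using N.q_value_mono[of W' W g, OF _ that] g \<delta>[OF that] by fastforce
  have "g \<in> (\<lambda>x. W' x - W x) ` X"
    unfolding g_def using M.finite_X xa by (intro Max_in) auto
  then obtain y where y: "y \<in> X" "g = W' y - W y"
    by auto
  obtain b where b: "b \<in> A" "N.q_value W' y b = W' y"
    using N.ex_bellman[of W' y] W'[OF y(1)] by auto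
  have "W' y \<le> W y + (\<delta> + \<alpha> * g)"
    using step[OF y(1) b(1)] M.q_value_le_bellman[OF b(1), of W y] W[OF y(1)] b(2) by linarith
  then have "g \<le> \<delta> + \<alpha> * g"
    using y(2) by linarith
  then have "g * (1 - \<alpha>) \<le> \<delta>"
    by (simp add: algebra_simps)
  then have "g \<le> \<delta> / (1 - \<alpha>)"
    using M.\<alpha> by (simp add: pos_le_divide_eq)
  then have "\<delta> + \<alpha> * g \<le> \<delta> + \<alpha> * (\<delta> / (1 - \<alpha>))"
    using M.\<alpha> by (intro add_left_mono mult_left_mono) auto
  \<comment> \<open>One more Bellman step reproduces the same bound, so q-values and values share
    the constant.\<close>
  also have "\<dots> = \<delta> / (1 - \<alpha>)"
    using M.\<alpha> by (simp add: field_simps)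
  finally show ?thesis
    using step[OF xa] by linarith
qed

text \<open>Both directions come from \<open>q_value_fixed_point_le\<close>. Passing from
  \<open>R\<close> to \<open>R'\<close> costs \<open>\<delta>\<close>, tested at \<open>W\<close>;
  in the other direction the error is 0, since an infimum over a smaller set is larger. The
  regularity of \<open>W'\<close> never enters.\<close>

lemma q_value_difference_le:
  assumes mdp: "finite_robust_mdp X A \<alpha> R" "finite_robust_mdp X A \<alpha> R'"
    and W: "\<And>x. x \<in> X \<Longrightarrow> finite_robust_mdp.bellman A r \<alpha> R W x = W x"
    and W': "\<And>x. x \<in> X \<Longrightarrow> finite_robust_mdp.bellman A r \<alpha> R' W' x = W' x"
    and sub: "\<And>x a. x \<in> X \<Longrightarrow> a \<in> A \<Longrightarrow> R' x a \<subseteq> R x a"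
    and \<delta>: "\<And>x a P. x \<in> X \<Longrightarrow> a \<in> A \<Longrightarrow> P \<in> R x a \<Longrightarrow>
      \<exists>P'\<in>R' x a. (\<integral>y. r x a y + \<alpha> * W y \<partial>P') \<le> (\<integral>y. r x a y + \<alpha> * W y \<partial>P) + \<delta>"
    and xa: "x \<in> X" "a \<in> A"
  shows "\<bar>finite_robust_mdp.q_value r \<alpha> R W x a - finite_robust_mdp.q_value r \<alpha> R' W' x a\<bar> \<le> \<delta> / (1 - \<alpha>)"
proof -
  interpret M: finite_robust_mdp X A r \<alpha> R by fact
  interpret N: finite_robust_mdp X A r \<alpha> R' by fact
  have "N.q_value W y b - \<delta> \<le> M.q_value W y b" if yb: "y \<in> X" "b \<in> A" for y b
    unfolding M.q_value_def
  proof (rule cINF_greatest[OF M.R_nonempty[OF yb]])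
    fix P assume "P \<in> R y b"
    from \<delta>[OF yb this] show "N.q_value W y b - \<delta> \<le> (\<integral>z. r y b z + \<alpha> * W z \<partial>P)"
      using N.q_value_le[OF yb, of _ W] by fastforce
  qed
  then have "N.q_value W' x a \<le> M.q_value W x a + \<delta> / (1 - \<alpha>)"
    using q_value_fixed_point_le[OF mdp W W', of \<delta> x a] xa by (simp add: algebra_simps)
  moreover have "M.q_value W' y b \<le> N.q_value W' y b" if yb: "y \<in> X" "b \<in> A" for y b
    unfolding N.q_value_def using sub[OF yb] by (intro cINF_greatest[OF N.R_nonempty[OF yb]] M.q_value_le[OF yb]) auto
  then have "M.q_value W x a \<le> N.q_value W' x a"
    using q_value_fixed_point_le[OF mdp(2,1) W' W, of 0 x a] xa by simp
  ultimately show ?thesis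
    by linarith
qed

lemma integral_M1_cong:
  "P \<in> M1 X \<Longrightarrow> (\<And>x. x \<in> X \<Longrightarrow> f x = g x) \<Longrightarrow> (\<integral>x. f x \<partial>P) = (\<integral>x. g x \<partial>P :: real)"
  by (intro Bochner_Integration.integral_cong) (auto simp: space_prob_algebra dest: sets_eq_imp_space_eq)

text \<open>Finiteness of \<open>V\<close> on \<open>X\<close>, and of \<open>Vn n\<close> for
  \<open>n \<ge> n0\<close>, belongs to the conclusion: it ensures that \<open>real_of_ereal\<close>
  in \<open>Q\<close> and \<open>Qn\<close> returns the actual values.\<close>

theorem lemma4p4:
  fixes X :: "(real ^ 'd) set" and A :: "(real ^ 'm) set"
    and r :: "real ^ 'd \<Rightarrow> real ^ 'm \<Rightarrow> real ^ 'd \<Rightarrow> real"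
    and \<alpha> \<epsilon> :: real and q :: nat
    and Phat :: "real ^ 'd \<Rightarrow> real ^ 'm \<Rightarrow> (real ^ 'd) measure"
  assumes "finite X" "X \<noteq> {}" "finite A" "A \<noteq> {}"
    and "0 < \<alpha>" "\<alpha> < 1" "\<epsilon> > 0" "q \<ge> 1"
    and "\<And>x a. x \<in> X \<Longrightarrow> a \<in> A \<Longrightarrow> Phat x a \<in> M1 X"
    and "\<And>x a. x \<in> X \<Longrightarrow> a \<in> A \<Longrightarrow>
      ((\<lambda>(x', a'). wasserstein X q (Phat x' a') (Phat x a)) \<longlongrightarrow> 0) (at (x, a) within X \<times> A)"
  defines "Pq \<equiv> \<lambda>x a. wasserstein_ball X q \<epsilon> (Phat x a)"
  defines "Pn \<equiv> \<lambda>n x a. Pq x a \<inter> grid_measures X n"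
  defines "V \<equiv> robust_value \<alpha> r X A Pq"
    and "Vn \<equiv> \<lambda>n. robust_value \<alpha> r X A (Pn n)"
  defines "Q \<equiv> \<lambda>x a. INF P\<in>Pq x a. ereal (\<integral>y. r x a y + \<alpha> * real_of_ereal (V y) \<partial>P)"
    and "Qn \<equiv> \<lambda>n x a. INF P\<in>Pn n x a. ereal (\<integral>y. r x a y + \<alpha> * real_of_ereal (Vn n y) \<partial>P)"
    and "diam \<equiv> Max ((\<lambda>(y, y'). norm (y - y')) ` (X \<times> X))"
    and "Lr \<equiv> Max ((\<lambda>(x, a). max_slope X (\<lambda>y. ereal (r x a y))) ` (X \<times> A))"
    and "LV \<equiv> max_slope X V"
  defines "C \<equiv> (Lr + ereal \<alpha> * LV) * ereal (\<epsilon> + diam * real (card X) powr (1 / real q)) / ereal (1 - \<alpha>)"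
  shows
    "(\<forall>x\<in>X. \<forall>a\<in>A. \<forall>P\<in>Pq x a. \<forall>p\<ge>1. \<forall>n\<ge>1. \<exists>P'\<in>grid_measures X n.
        wasserstein X p P' P \<le> diam * real (card X) powr (1 / real p) / real n powr (1 / real p)) \<and>
     (\<forall>x\<in>X. \<bar>V x\<bar> \<noteq> \<infinity>) \<and> Lr < \<infinity> \<and> LV < \<infinity> \<and> C < \<infinity> \<and>
     (\<exists>n0\<ge>1. \<forall>n\<ge>n0. (\<forall>x\<in>X. \<bar>Vn n x\<bar> \<noteq> \<infinity>) \<and>
        (SUP (x, a)\<in>X \<times> A. \<bar>Q x a - Qn n x a\<bar>) \<le> C / ereal (real n powr (1 / real q)))"
proof -
  have fin: "finite X" and finA: "finite A" and A: "A \<noteq> {}" and \<epsilon>: "0 < \<epsilon>" "0 \<le> \<epsilon>" and q: "1 \<le> q"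
    and \<alpha>: "0 \<le> \<alpha>" "\<alpha> < 1" and Phat: "\<And>x a. x \<in> X \<Longrightarrow> a \<in> A \<Longrightarrow> Phat x a \<in> M1 X"
    using assms(1-9) by auto
  have diam: "norm (x - y) \<le> diam" if "x \<in> X" "y \<in> X" for x y
    unfolding diam_def using that fin by (intro Max_ge) (auto intro!: image_eqI[of _ _ "(x, y)"])
  then have diam_ball: "\<forall>x\<in>X. \<forall>y\<in>X. norm (x - y) \<le> diam"
    by blast
  have diam0: "0 \<le> diam"
    using diam assms(2) norm_ge_zero order_trans by (metis ex_in_conv)
  define b where "b n = (\<epsilon> + diam * real (card X) powr (1 / real q)) / real n powr (1 / real q)" for n
  have Pq_M1: "Pq x a \<subseteq> M1 X" for x a
    by (auto simp: Pq_def wasserstein_ball_def)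
  have mdp: "finite_robust_mdp X A \<alpha> Pq"
  proof
    show "Pq x a \<noteq> {}" if "x \<in> X" "a \<in> A" for x a
      unfolding Pq_def using center_in_wasserstein_ball[OF fin Phat[OF that] \<epsilon>(2) q] by auto
  qed (use fin finA A \<alpha> Pq_M1 in auto)
  interpret M: finite_robust_mdp X A r \<alpha> Pq by (rule mdp)
  obtain W where W: "\<And>x. x \<in> X \<Longrightarrow> V x = ereal (W x)" "\<And>x. x \<in> X \<Longrightarrow> M.bellman W x = W x"
    using M.robust_value_bellman unfolding V_def by blast
  obtain lV where lV: "0 \<le> lV" "LV = ereal lV" "\<And>x y. x \<in> X \<Longrightarrow> y \<in> X \<Longrightarrow> \<bar>W x - W y\<bar> \<le> lV * norm (x - y)"
    using max_slope_real[OF fin, of V W] W(1) unfolding LV_def by blast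
  have slope: "\<exists>L\<ge>0. max_slope X (\<lambda>y. ereal (r x a y)) = ereal L \<and>
      (\<forall>y\<in>X. \<forall>z\<in>X. \<bar>r x a y - r x a z\<bar> \<le> L * norm (y - z))" for x a
    using fin by (rule max_slope_real) simp
  let ?S = "(\<lambda>(x, a). max_slope X (\<lambda>y. ereal (r x a y))) ` (X \<times> A)"
  have S: "finite ?S" "?S \<noteq> {}"
    using assms(2) fin finA A by auto
  have "Lr \<in> ?S"
    unfolding Lr_def using S by (rule Max_in)
  then obtain x a where Lr_eq: "Lr = max_slope X (\<lambda>y. ereal (r x a y))"
    by auto
  obtain lr where lr: "0 \<le> lr" "Lr = ereal lr"
    unfolding Lr_eq using slope[of x a] by blast
  have r_slope: "\<bar>r x a y - r x a z\<bar> \<le> lr * norm (y - z)" if "x \<in> X" "a \<in> A" "y \<in> X" "z \<in> X" for x a y z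
  proof -
    obtain L where L: "max_slope X (\<lambda>y. ereal (r x a y)) = ereal L"
        "\<forall>y\<in>X. \<forall>z\<in>X. \<bar>r x a y - r x a z\<bar> \<le> L * norm (y - z)"
      using slope[of x a] by metis
    have "ereal L \<le> Lr"
      unfolding Lr_def L(1)[symmetric] using S(1) that by (intro Max_ge) auto
    then have "L * norm (y - z) \<le> lr * norm (y - z)"
      by (simp add: lr mult_right_mono)
    moreover have "\<bar>r x a y - r x a z\<bar> \<le> L * norm (y - z)"
      using bspec[OF bspec[OF L(2) that(3)] that(4)] .
    ultimately show ?thesis by linarith
  qed
  \<comment> \<open>A Lipschitz constant on \<open>X\<close> of
    \<open>r x a y + \<alpha> * W y\<close> in \<open>y\<close>, the integrand of the Bellman
    operator. It is the factor of \<open>C\<close> coming from \<open>Lr\<close> and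
    \<open>LV\<close>.\<close>
  define l where "l = lr + \<alpha> * lV"
  have l0: "0 \<le> l"
    using lr lV \<alpha> by (simp add: l_def)
  have l_slope: "\<bar>(r x a y + \<alpha> * W y) - (r x a z + \<alpha> * W z)\<bar> \<le> l * norm (y - z)"
    if "x \<in> X" "a \<in> A" "y \<in> X" "z \<in> X" for x a y z
  proof -
    have "\<bar>\<alpha> * (W y - W z)\<bar> \<le> \<alpha> * (lV * norm (y - z))"
      unfolding abs_mult using \<alpha> lV(3)[OF that(3,4)] by (simp add: mult_left_mono)
    then show ?thesis
      using r_slope[OF that] by (simp add: l_def distrib_right right_diff_distrib)
  qed
  have C: "C = ereal (l * (\<epsilon> + diam * real (card X) powr (1 / real q)) / (1 - \<alpha>))"
    using \<alpha> by (simp add: C_def lr lV l_def)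
  \<comment> \<open>With one-step error \<open>l * b n\<close>, the bound of
    \<open>q_value_difference_le\<close> becomes the claimed right-hand side.\<close>
  have Cb: "ereal (l * b n / (1 - \<alpha>)) = C / ereal (real n powr (1 / real q))" if "1 \<le> n" for n
    using that by (simp add: C b_def)
  have Q: "Q x a = ereal (M.q_value W x a)" if "x \<in> X" "a \<in> A" for x a
  proof -
    have "Q x a = (INF P\<in>Pq x a. ereal (\<integral>y. r x a y + \<alpha> * W y \<partial>P))"
      unfolding Q_def
    proof (rule INF_cong[OF refl])
      fix P assume "P \<in> Pq x a"
      then have "P \<in> M1 X"
        using Pq_M1 by blast
      then have "(\<integral>y. r x a y + \<alpha> * real_of_ereal (V y) \<partial>P) = (\<integral>y. r x a y + \<alpha> * W y \<partial>P)"
        by (rule integral_M1_cong) (simp add: W(1))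
      then show "ereal (\<integral>y. r x a y + \<alpha> * real_of_ereal (V y) \<partial>P) = ereal (\<integral>y. r x a y + \<alpha> * W y \<partial>P)"
        by simp
    qed
    then show ?thesis
      using M.ereal_q_value[OF that] by simp
  qed
  have "\<forall>\<^sub>F n in sequentially. (\<forall>x\<in>X. \<bar>Vn n x\<bar> \<noteq> \<infinity>) \<and>
      (SUP (x, a)\<in>X \<times> A. \<bar>Q x a - Qn n x a\<bar>) \<le> C / ereal (real n powr (1 / real q))"
    using eventually_grid_approximation[OF fin diam0 diam_ball \<epsilon>(1) q] eventually_ge_at_top[of 1]
  proof eventually_elim
    case (elim n)
    have approx: "\<exists>P'\<in>Pn n x a. (\<integral>y. r x a y + \<alpha> * W y \<partial>P') \<le> (\<integral>y. r x a y + \<alpha> * W y \<partial>P) + l * b n"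
      if "x \<in> X" "a \<in> A" "P \<in> Pq x a" for x a P
    proof -
      have "P \<in> wasserstein_ball X q \<epsilon> (Phat x a)"
        using that(3) by (simp add: Pq_def)
      from bspec[OF bspec[OF elim(1) Phat[OF that(1,2)]] this]
      obtain P' where P': "P' \<in> wasserstein_ball X q \<epsilon> (Phat x a) \<inter> grid_measures X n"
        and le: "\<forall>f L. 0 \<le> L \<longrightarrow> (\<forall>x\<in>X. \<forall>y\<in>X. \<bar>f x - f y\<bar> \<le> L * norm (x - y)) \<longrightarrow>
          (\<integral>x. f x \<partial>P') \<le> (\<integral>x. f x \<partial>P) + L * b n"
        unfolding b_def by (rule bexE)
      have "\<forall>y\<in>X. \<forall>z\<in>X. \<bar>(r x a y + \<alpha> * W y) - (r x a z + \<alpha> * W z)\<bar> \<le> l * norm (y - z)"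
        using l_slope[OF that(1,2)] by (intro ballI)
      then have "(\<integral>y. r x a y + \<alpha> * W y \<partial>P') \<le> (\<integral>y. r x a y + \<alpha> * W y \<partial>P) + l * b n"
        using le[THEN spec, of "\<lambda>y. r x a y + \<alpha> * W y", THEN spec, of l] l0 by iprover
      with P' show ?thesis
        unfolding Pn_def Pq_def by (rule rev_bexI)
    qed
    have sub: "Pn n x a \<subseteq> Pq x a" for x a
      by (auto simp: Pn_def)
    have mdp_n: "finite_robust_mdp X A \<alpha> (Pn n)"
    proof
      show "Pn n x a \<subseteq> M1 X" for x a
        using sub Pq_M1 by (rule order_trans)
      \<comment> \<open>For small \<open>n\<close> the ball may contain no grid law; for the present
        \<open>n\<close> the approximant of any law in the ball is one.\<close>
      show "Pn n x a \<noteq> {}" if xa: "x \<in> X" "a \<in> A" for x a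
      proof -
        obtain P where "P \<in> Pq x a"
          using M.R_nonempty[OF xa] by auto
        from approx[OF xa this] show ?thesis by auto
      qed
    qed (use fin finA A \<alpha> in auto)
    interpret N: finite_robust_mdp X A r \<alpha> "Pn n" by (rule mdp_n)
    obtain W' where W': "\<And>x. x \<in> X \<Longrightarrow> Vn n x = ereal (W' x)" "\<And>x. x \<in> X \<Longrightarrow> N.bellman W' x = W' x"
      using N.robust_value_bellman unfolding Vn_def by blast
    have Qn: "Qn n x a = ereal (N.q_value W' x a)" if "x \<in> X" "a \<in> A" for x a
    proof -
      have "Qn n x a = (INF P\<in>Pn n x a. ereal (\<integral>y. r x a y + \<alpha> * W' y \<partial>P))"
        unfolding Qn_def
      proof (rule INF_cong[OF refl])
        fix P assume "P \<in> Pn n x a"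
        then have "P \<in> M1 X"
          using Pq_M1 sub by blast
        then have "(\<integral>y. r x a y + \<alpha> * real_of_ereal (Vn n y) \<partial>P) = (\<integral>y. r x a y + \<alpha> * W' y \<partial>P)"
          by (rule integral_M1_cong) (simp add: W'(1))
        then show "ereal (\<integral>y. r x a y + \<alpha> * real_of_ereal (Vn n y) \<partial>P) = ereal (\<integral>y. r x a y + \<alpha> * W' y \<partial>P)"
          by simp
      qed
      then show ?thesis
        using N.ereal_q_value[OF that] by simp
    qed
    have "\<bar>Q x a - Qn n x a\<bar> \<le> C / ereal (real n powr (1 / real q))" if "x \<in> X" "a \<in> A" for x a
      using q_value_difference_le[OF mdp mdp_n W(2) W'(2) sub approx that]
      by (simp add: Q Qn that flip: Cb[OF elim(2)])
    then show ?case
      using W' by (auto intro!: SUP_least)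
  qed
  then obtain n0 where n0: "\<forall>n\<ge>n0. (\<forall>x\<in>X. \<bar>Vn n x\<bar> \<noteq> \<infinity>) \<and>
      (SUP (x, a)\<in>X \<times> A. \<bar>Q x a - Qn n x a\<bar>) \<le> C / ereal (real n powr (1 / real q))"
    unfolding eventually_sequentially by blast
  have "\<exists>P'\<in>grid_measures X n.
      wasserstein X p P' P \<le> diam * real (card X) powr (1 / real p) / real n powr (1 / real p)"
    if "P \<in> Pq x a" "1 \<le> p" "1 \<le> n" for x a P and p n :: nat
    using that Pq_M1[of x a] diam diam0 by (intro grid_measure_near[OF fin]) auto
  moreover have "\<exists>n0\<ge>1. \<forall>n\<ge>n0. (\<forall>x\<in>X. \<bar>Vn n x\<bar> \<noteq> \<infinity>) \<and>
      (SUP (x, a)\<in>X \<times> A. \<bar>Q x a - Qn n x a\<bar>) \<le> C / ereal (real n powr (1 / real q))"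
    using n0 by (intro exI[of _ "max 1 n0"]) auto
  moreover have "\<forall>x\<in>X. \<bar>V x\<bar> \<noteq> \<infinity>"
    using W(1) by simp
  moreover have "Lr < \<infinity>" "LV < \<infinity>" "C < \<infinity>"
    by (simp_all add: lr lV C)
  ultimately show ?thesis
    by blast
qed

end
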